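(* Fix a time step $n\ge 1$. Assume that for each $\ell\in\{1,2\}$: (i) $k_\ell:[0,1]\to[m_{k_\ell},M_{k_\ell}]$ is Lipschitz continuous with $0<m_{k_\ell}\le M_{k_\ell}<\infty$; consequently $k_\ell^{-1}:=1/k_\ell:[0,1]\to[m_{\bar k_\ell},M_{\bar k_\ell}]$ is Lipschitz continuous with $0<m_{\bar k_\ell}\le M_{\bar k_\ell}<\infty$ and Lipschitz constant $L_{\bar k_\ell}$; (ii) $S_\ell:\mathbb{R}\to[0,1]$ is monotonically increasing and Lipschitz continuous with Lipschitz constant $L_{S_\ell}$; (iii) the solution $(\mathbf{q}^n,p^n,g^n)\in Q\times P\times G$ of the limit problem satisfies $\lVert \mathbf{q}^n_\ell\rVert_{L^\infty(\Omega_\ell)}\le M_{\mathbf{q}_\ell}<\infty$; (iv) $L_\ell>\tfrac12 L_{S_\ell}$, $\alpha>0$, and $\tau<\Bigl(\frac{1}{L_{S_\ell}}-\frac{1}{2L_\ell}\Bigr)\frac{2m_{\bar k_\ell}}{L_{\bar k_\ell}^2M_{\mathbf{q}_\ell}^2}$. Let $(\mathbf{q}^i,p^i,g^i)_{i\ge 1}$ be generated by the iterative scheme from arbitrary $(\mathbf{q}^0,p^0,g^0)\in Q\times P\times G$. Then the (subdomain-wise) divergence of the flux $\nabla\cdot\mathbf{q}^i$ converges strongly to $\nabla\cdot\mathbf{q}^n$: $$\lim_{i\to\infty}\lVert\nabla\cdot(\mathbf{q}^n-\mathbf{q}^i)\rVert=0.$$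
   Context: Geometry. $\Omega\subset\mathbb{R}^d$, $d\in\{2,3\}$, is an open bounded domain with Lipschitz boundary partitioned into a Dirichlet part $\partial\Omega_D$ and a Neumann part $\partial\Omega_N$ ($\partial\Omega=\overline{\partial\Omega}_D\cup\overline{\partial\Omega}_N$, $\partial\Omega_D\cap\partial\Omega_N=\emptyset$). $\Omega$ is partitioned into two non-overlapping Lipschitz subdomains, $\overline\Omega=\overline\Omega_1\cup\overline\Omega_2$, $\Omega_1\cap\Omega_2=\emptyset$, with interface $\Gamma:=\partial\Omega_1\cap\partial\Omega_2$, a $(d-1)$-dimensional manifold. Each subdomain borders part of the Dirichlet boundary: $\partial\Omega_\ell\cap\partial\Omega_D\neq\emptyset$ (understood as having positive $(d-1)$-dimensional measure), $\ell\in\{1,2\}$. $\mathbf{n}_\ell$ is the outward unit normal on $\partial\Omega_\ell$, so $\mathbf{n}_1=-\mathbf{n}_2$ on $\Gamma$. Spaces. $\langle\cdot,\cdot\rangle_X$ is the $L^2(X)$ inner product. $$Q_\ell:=\{\tilde{\mathbf{q}}_\ell\in H(\mathrm{div};\Omega_\ell)\mid (\tilde{\mathbf{q}}_\ell\cdot\mathbf{n}_\ell)|_\Gamma\in L^2(\Gamma),\ (\tilde{\mathbf{q}}_\ell\cdot\mathbf{n}_\ell)|_{\partial\Omega_N\cap\partial\Omega_\ell}=0\},\qquad P_\ell:=L^2(\Omega_\ell),$$ $Q:=Q_1\times Q_2$, $P:=P_1\times P_2$, $G:=[L^2(\Gamma)]^2$. A quantity without subscript $\ell$ denotes the pair of its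 subdomain restrictions (in particular $\nabla\cdot\mathbf{q}=(\nabla\cdot\mathbf{q}_1,\nabla\cdot\mathbf{q}_2)\in P$ for $\mathbf{q}\in Q$), and $\lVert u\rVert^2:=\sum_{\ell=1}^2\lVert u_\ell\rVert^2_{L^2(\Omega_\ell)}$. Data. $\tau>0$ (time step), $\alpha>0$ (Robin parameter), $L_\ell>0$ (stabilization parameters), $\mathcal{F}_\ell\in L^2(\Omega_\ell)$, $\nabla\eta_\ell\in[L^2(\Omega_\ell)]^d$, and $S_\ell^{n-1}:=S_\ell(p_\ell^{n-1})$ with $p^{n-1}\in P$ given (the previous time step). $k_\ell$ is the permeability and $S_\ell$ the saturation function. The Lipschitz constants and bounds appearing in denominators are taken positive. Limit problem. Find $\mathbf{q}^n\in Q$, $p^n\in P$, $g^n\in G$ such that, with $S_\ell^n:=S_\ell(p_\ell^n)$, $\bar k_\ell^n:=k_\ell^{-1}(S_\ell(p_\ell^n))$, for all $\tilde{\mathbf{q}}\in Q$, $\tilde p\in P$, $\tilde g\in G$ and $\ell,j\in\{1,2\}$, $\ell\ne j$, $$\langle\bar k_\ell^n\mathbf{q}_\ell^n,\tilde{\mathbf{q}}_\ell\rangle_{\Omega_\ell}-\langle p_\ell^n,\nabla\cdot\tilde{\mathbf{q}}_\ell\rangle_{\Omega_\ell}+\alpha\langle\mathbf{q}_\ell^n\cdot\mathbf{n}_\ell,\tilde{\mathbf{q}}_\ell\cdot\mathbf{n}_\ell\rangle_\Gamma=\langle\nabla\eta_\ell,\tilde{\mathbf{q}}_\ell\rangle_{\Omega_\ell}-\langle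 g_\ell^n,\tilde{\mathbf{q}}_\ell\cdot\mathbf{n}_\ell\rangle_\Gamma,$$ $$\langle S_\ell^n,\tilde p_\ell\rangle_{\Omega_\ell}+\tau\langle\nabla\cdot\mathbf{q}_\ell^n,\tilde p_\ell\rangle_{\Omega_\ell}=\tau\langle\mathcal{F}_\ell,\tilde p_\ell\rangle_{\Omega_\ell}+\langle S_\ell^{n-1},\tilde p_\ell\rangle_{\Omega_\ell},$$ $$\langle g_\ell^n,\tilde g_\ell\rangle_\Gamma=\langle 2\alpha\,\mathbf{q}_j^n\cdot\mathbf{n}_j+g_j^n,\tilde g_\ell\rangle_\Gamma.$$ This problem is taken to have a (unique) solution. Iterative scheme (the index $n$ is dropped on iterates). For $i\ge1$, given $(\mathbf{q}^{i-1},p^{i-1},g^{i-1})\in Q\times P\times G$, set $S_\ell^{i-1}:=S_\ell(p_\ell^{i-1})$, $\bar k_\ell^{i-1}:=k_\ell^{-1}(S_\ell(p_\ell^{i-1}))$; compute $g^i\in G$ from $$\langle g_\ell^i,\tilde g_\ell\rangle_\Gamma=\langle2\alpha\,\mathbf{q}_j^{i-1}\cdot\mathbf{n}_j+g_j^{i-1},\tilde g_\ell\rangle_\Gamma\quad(\ell\neq j)\ \text{ for all }\tilde g\in G,$$ and then find $\mathbf{q}^i\in Q$, $p^i\in P$ such that for all $\tilde{\mathbf{q}}\in Q$, $\tilde p\in P$, $\ell\in\{1,2\}$, $$\langle\bar k_\ell^{i-1}\mathbf{q}_\ell^i,\tilde{\mathbf{q}}_\ell\rangle_{\Omega_\ell}-\langle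 p_\ell^i,\nabla\cdot\tilde{\mathbf{q}}_\ell\rangle_{\Omega_\ell}+\alpha\langle\mathbf{q}_\ell^i\cdot\mathbf{n}_\ell,\tilde{\mathbf{q}}_\ell\cdot\mathbf{n}_\ell\rangle_\Gamma=\langle\nabla\eta_\ell,\tilde{\mathbf{q}}_\ell\rangle_{\Omega_\ell}-\langle g_\ell^i,\tilde{\mathbf{q}}_\ell\cdot\mathbf{n}_\ell\rangle_\Gamma,$$ $$L_\ell\langle p_\ell^i,\tilde p_\ell\rangle_{\Omega_\ell}+\tau\langle\nabla\cdot\mathbf{q}_\ell^i,\tilde p_\ell\rangle_{\Omega_\ell}=\tau\langle\mathcal{F}_\ell,\tilde p_\ell\rangle_{\Omega_\ell}-\langle S_\ell^{i-1}-S_\ell^{n-1},\tilde p_\ell\rangle_{\Omega_\ell}+L_\ell\langle p_\ell^{i-1},\tilde p_\ell\rangle_{\Omega_\ell}.$$ Each step of the scheme is well-posed. *)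

theory Defs
  imports "HOL-Analysis.Analysis" "HOL-Probability.Essential_Supremum"
begin

section \<open>Surface measure\<close>

text \<open>
  The \<open>s\<close>-dimensional Hausdorff outer measure for \<open>s \<ge> 1\<close>, normalised so that it agrees with
  Lebesgue measure when \<open>s\<close> is the dimension of the space. Covering sets have to be bounded
  because \<open>diameter\<close> is unspecified for unbounded sets.
\<close>

definition hausdorff_outer :: "nat \<Rightarrow> 'a::euclidean_space set \<Rightarrow> ennreal" where
  "hausdorff_outer s A =
    (SUP \<delta>\<in>{0<..}. INF U\<in>{U :: nat \<Rightarrow> 'a set. A \<subseteq> (\<Union>i. U i) \<and>
                                (\<forall>i. bounded (U i) \<and> diameter (U i) < \<delta>)}.
      \<Sum>i. ennreal (unit_ball_vol (real s) * (diameter (U i) / 2) ^ s))"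

text \<open>
  The outer measure above is a metric outer measure, hence countably additive on the Borel sets,
  so \<open>measure_of\<close> does not fall back to the zero measure.
\<close>

definition surface_measure :: "'a::euclidean_space set \<Rightarrow> 'a measure" where
  "surface_measure A =
    restrict_space (measure_of UNIV (sets borel) (hausdorff_outer (DIM('a) - 1))) A"


section \<open>Geometry\<close>

text \<open>Near every boundary point, the set is the strict subgraph of a Lipschitz function in the
  direction of some unit vector \<open>e\<close>; \<open>y - (y \<bullet> e) *\<^sub>R e\<close> is the projection along \<open>e\<close>.\<close>

definition lipschitz_boundary :: "'a::euclidean_space set \<Rightarrow> bool" where
  "lipschitz_boundary \<Omega> \<longleftrightarrow>
    (\<forall>x\<in>frontier \<Omega>. \<exists>U e \<gamma> C. open U \<and> x \<in> U \<and> norm e = 1 \<and>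
       C-lipschitz_on {y. y \<bullet> e = 0} \<gamma> \<and>
       \<Omega> \<inter> U = {y\<in>U. y \<bullet> e < \<gamma> (y - (y \<bullet> e) *\<^sub>R e)})"

definition lipschitz_domain :: "'a::euclidean_space set \<Rightarrow> bool" where
  "lipschitz_domain \<Omega> \<longleftrightarrow>
    open \<Omega> \<and> connected \<Omega> \<and> \<Omega> \<noteq> {} \<and> bounded \<Omega> \<and> lipschitz_boundary \<Omega>"

text \<open>A topological manifold of codimension one, possibly with boundary: the model space is a
  closed half-space of a coordinate hyperplane.\<close>

definition hypersurface :: "'a::euclidean_space set \<Rightarrow> bool" where
  "hypersurface M \<longleftrightarrow>
    (\<forall>x\<in>M. \<exists>U (V :: 'a set). openin (top_of_set M) U \<and> x \<in> U \<and> U homeomorphic V \<and>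
       (\<exists>b\<in>Basis. \<exists>c\<in>Basis. b \<noteq> c \<and> openin (top_of_set {y. y \<bullet> b = 0 \<and> y \<bullet> c \<ge> 0}) V))"

text \<open>In the following, \<open>\<Omega>s 1\<close> and \<open>\<Omega>s 2\<close> are the two subdomains; families of subdomain quantities
  are functions on \<open>nat\<close> of which only the values at 1 and 2 matter.\<close>

definition interface :: "(nat \<Rightarrow> 'a::euclidean_space set) \<Rightarrow> 'a set" where
  "interface \<Omega>s = frontier (\<Omega>s 1) \<inter> frontier (\<Omega>s 2)"

definition two_domain_geometry ::
    "'a::euclidean_space set \<Rightarrow> 'a set \<Rightarrow> 'a set \<Rightarrow> (nat \<Rightarrow> 'a set) \<Rightarrow> bool" where
  "two_domain_geometry \<Omega> D N \<Omega>s \<longleftrightarrow>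
    lipschitz_domain \<Omega> \<and>
    frontier \<Omega> = closure D \<union> closure N \<and> D \<inter> N = {} \<and>
    (\<forall>l\<in>{1,2}. lipschitz_domain (\<Omega>s l) \<and> \<Omega>s l \<subseteq> \<Omega>) \<and>
    closure \<Omega> = closure (\<Omega>s 1) \<union> closure (\<Omega>s 2) \<and> \<Omega>s 1 \<inter> \<Omega>s 2 = {} \<and>
    hypersurface (interface \<Omega>s) \<and>
    (\<forall>l\<in>{1,2}. hausdorff_outer (DIM('a) - 1) (frontier (\<Omega>s l) \<inter> D) > 0)"


section \<open>Square-integrable functions\<close>

definition L2 :: "'a measure \<Rightarrow> ('a \<Rightarrow> 'b::euclidean_space) set" where
  "L2 M = {f \<in> borel_measurable M. integrable M (\<lambda>x. (norm (f x))\<^sup>2)}"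

definition L2_inner :: "'a measure \<Rightarrow> ('a \<Rightarrow> 'b::euclidean_space) \<Rightarrow> ('a \<Rightarrow> 'b) \<Rightarrow> real" where
  "L2_inner M f g = (\<integral>x. f x \<bullet> g x \<partial>M)"

definition L2_norm :: "'a measure \<Rightarrow> ('a \<Rightarrow> 'b::euclidean_space) \<Rightarrow> real" where
  "L2_norm M f = sqrt (\<integral>x. (norm (f x))\<^sup>2 \<partial>M)"


section \<open>Weak derivatives\<close>

primrec Ck :: "nat \<Rightarrow> ('a::euclidean_space \<Rightarrow> real) \<Rightarrow> bool" where
  "Ck 0 f \<longleftrightarrow> continuous_on UNIV f"
| "Ck (Suc m) f \<longleftrightarrow> (\<forall>x. f differentiable (at x)) \<and>
     (\<forall>b\<in>Basis. Ck m (\<lambda>x. frechet_derivative f (at x) b))"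

definition smooth :: "('a::euclidean_space \<Rightarrow> real) \<Rightarrow> bool" where
  "smooth f \<longleftrightarrow> (\<forall>m. Ck m f)"

definition grad :: "('a::euclidean_space \<Rightarrow> real) \<Rightarrow> 'a \<Rightarrow> 'a" where
  "grad \<phi> x = (\<Sum>b\<in>Basis. frechet_derivative \<phi> (at x) b *\<^sub>R b)"

definition test_functions :: "'a::euclidean_space set \<Rightarrow> ('a \<Rightarrow> real) set" where
  "test_functions \<Omega> = {\<phi>. smooth \<phi> \<and>
     compact (closure {x. \<phi> x \<noteq> 0}) \<and> closure {x. \<phi> x \<noteq> 0} \<subseteq> \<Omega>}"

definition has_weak_grad ::
    "'a::euclidean_space set \<Rightarrow> ('a \<Rightarrow> real) \<Rightarrow> ('a \<Rightarrow> 'a) \<Rightarrow> bool" where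
  "has_weak_grad \<Omega> u v \<longleftrightarrow>
    (\<forall>K. compact K \<and> K \<subseteq> \<Omega> \<longrightarrow> integrable (lebesgue_on K) u \<and> integrable (lebesgue_on K) v) \<and>
    (\<forall>\<phi>\<in>test_functions \<Omega>. \<forall>b\<in>Basis.
       L2_inner (lebesgue_on \<Omega>) u (\<lambda>x. grad \<phi> x \<bullet> b) =
       - L2_inner (lebesgue_on \<Omega>) (\<lambda>x. v x \<bullet> b) \<phi>)"

definition has_weak_div ::
    "'a::euclidean_space set \<Rightarrow> ('a \<Rightarrow> 'a) \<Rightarrow> ('a \<Rightarrow> real) \<Rightarrow> bool" where
  "has_weak_div \<Omega> q v \<longleftrightarrow>
    (\<forall>\<phi>\<in>test_functions \<Omega>.
       L2_inner (lebesgue_on \<Omega>) q (grad \<phi>) = - L2_inner (lebesgue_on \<Omega>) v \<phi>)"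

definition Hdiv :: "'a::euclidean_space set \<Rightarrow> ('a \<Rightarrow> 'a) set" where
  "Hdiv \<Omega> = {q \<in> L2 (lebesgue_on \<Omega>). \<exists>v \<in> L2 (lebesgue_on \<Omega>). has_weak_div \<Omega> q v}"

text \<open>Determined up to a null set for \<open>q \<in> Hdiv \<Omega>\<close>.\<close>

definition weak_div :: "'a::euclidean_space set \<Rightarrow> ('a \<Rightarrow> 'a) \<Rightarrow> 'a \<Rightarrow> real" where
  "weak_div \<Omega> q = (SOME v. v \<in> L2 (lebesgue_on \<Omega>) \<and> has_weak_div \<Omega> q v)"


section \<open>Normal traces\<close>

text \<open>
  For \<open>q \<in> Hdiv \<Omega>\<close> the outward normal component on the boundary is the functional given by
  Green's formula, \<open>\<langle>q \<cdot> n, \<phi>\<rangle> = \<integral>\<^sub>\<Omega> q \<cdot> \<nabla>\<phi> + \<integral>\<^sub>\<Omega> (\<nabla> \<cdot> q) \<phi>\<close>.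
  The orientation of \<open>n\<close> is encoded in the signs.
\<close>

definition normal_functional ::
    "'a::euclidean_space set \<Rightarrow> ('a \<Rightarrow> 'a) \<Rightarrow> ('a \<Rightarrow> real) \<Rightarrow> real" where
  "normal_functional \<Omega> q \<phi> =
    L2_inner (lebesgue_on \<Omega>) q (grad \<phi>) + L2_inner (lebesgue_on \<Omega>) (weak_div \<Omega> q) \<phi>"

text \<open>
  \<open>has_normal_trace \<Omega> A q \<nu>\<close>: the restriction of this functional to the boundary portion \<open>A\<close>, that
  is, to test functions vanishing on the rest of the boundary, is the function \<open>\<nu>\<close>.
\<close>

definition has_normal_trace ::
    "'a::euclidean_space set \<Rightarrow> 'a set \<Rightarrow> ('a \<Rightarrow> 'a) \<Rightarrow> ('a \<Rightarrow> real) \<Rightarrow> bool" where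
  "has_normal_trace \<Omega> A q \<nu> \<longleftrightarrow>
    (\<forall>\<phi>. smooth \<phi> \<and> (\<forall>x \<in> frontier \<Omega> - A. \<phi> x = 0) \<longrightarrow>
       has_bochner_integral (surface_measure A) (\<lambda>x. \<nu> x * \<phi> x) (normal_functional \<Omega> q \<phi>))"


section \<open>Function spaces of the two-domain problem\<close>

definition interface_trace ::
    "(nat \<Rightarrow> 'a::euclidean_space set) \<Rightarrow> nat \<Rightarrow> ('a \<Rightarrow> 'a) \<Rightarrow> ('a \<Rightarrow> real) \<Rightarrow> bool" where
  "interface_trace \<Omega>s l q \<nu> \<longleftrightarrow>
    \<nu> \<in> L2 (surface_measure (interface \<Omega>s)) \<and> has_normal_trace (\<Omega>s l) (interface \<Omega>s) q \<nu>"

definition Q_local ::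
    "(nat \<Rightarrow> 'a::euclidean_space set) \<Rightarrow> 'a set \<Rightarrow> nat \<Rightarrow> ('a \<Rightarrow> 'a) set" where
  "Q_local \<Omega>s N l = {q \<in> Hdiv (\<Omega>s l).
     (\<exists>\<nu>. interface_trace \<Omega>s l q \<nu>) \<and>
     has_normal_trace (\<Omega>s l) (N \<inter> frontier (\<Omega>s l)) q (\<lambda>_. 0)}"

definition Q_space ::
    "(nat \<Rightarrow> 'a::euclidean_space set) \<Rightarrow> 'a set \<Rightarrow> (nat \<Rightarrow> 'a \<Rightarrow> 'a) set" where
  "Q_space \<Omega>s N = (\<Pi> l\<in>{1,2}. Q_local \<Omega>s N l)"

definition P_space :: "(nat \<Rightarrow> 'a::euclidean_space set) \<Rightarrow> (nat \<Rightarrow> 'a \<Rightarrow> real) set" where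
  "P_space \<Omega>s = (\<Pi> l\<in>{1,2}. L2 (lebesgue_on (\<Omega>s l)))"

definition G_space :: "(nat \<Rightarrow> 'a::euclidean_space set) \<Rightarrow> (nat \<Rightarrow> 'a \<Rightarrow> real) set" where
  "G_space \<Omega>s = (\<Pi> l\<in>{1,2}. L2 (surface_measure (interface \<Omega>s)))"

definition broken_norm ::
    "(nat \<Rightarrow> 'a::euclidean_space set) \<Rightarrow> (nat \<Rightarrow> 'a \<Rightarrow> 'b::euclidean_space) \<Rightarrow> real" where
  "broken_norm \<Omega>s u = sqrt (\<Sum>l\<in>{1,2}. (L2_norm (lebesgue_on (\<Omega>s l)) (u l))\<^sup>2)"


section \<open>The limit problem and the iterative scheme\<close>

text \<open>
  The normal trace on the interface is, like any element of an \<open>L\<^sup>2\<close> space, given by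
  representatives; the equations below are required for every representative. Members of
  \<open>Q_space\<close> have at least one by definition.
\<close>

text \<open>The flux equation with the coefficient \<open>1 / k\<close> evaluated at the pressure \<open>pk\<close>, the unknown
  pressure being \<open>p\<close>; \<open>d\<eta> l\<close> is the gradient of \<open>\<eta>\<close> on subdomain \<open>l\<close>.\<close>

definition flux_equation ::
    "(nat \<Rightarrow> 'a::euclidean_space set) \<Rightarrow> 'a set \<Rightarrow> (nat \<Rightarrow> real \<Rightarrow> real) \<Rightarrow> (nat \<Rightarrow> real \<Rightarrow> real) \<Rightarrow>
     real \<Rightarrow> (nat \<Rightarrow> 'a \<Rightarrow> 'a) \<Rightarrow> (nat \<Rightarrow> 'a \<Rightarrow> real) \<Rightarrow>
     (nat \<Rightarrow> 'a \<Rightarrow> 'a) \<Rightarrow> (nat \<Rightarrow> 'a \<Rightarrow> real) \<Rightarrow> (nat \<Rightarrow> 'a \<Rightarrow> real) \<Rightarrow> bool" where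
  "flux_equation \<Omega>s N k S \<alpha> d\<eta> pk q p g \<longleftrightarrow>
    (\<forall>q'\<in>Q_space \<Omega>s N. \<forall>l\<in>{1,2}. \<forall>\<nu> \<nu>'.
       interface_trace \<Omega>s l (q l) \<nu> \<and> interface_trace \<Omega>s l (q' l) \<nu>' \<longrightarrow>
       L2_inner (lebesgue_on (\<Omega>s l)) (\<lambda>x. (1 / k l (S l (pk l x))) *\<^sub>R q l x) (q' l)
       - L2_inner (lebesgue_on (\<Omega>s l)) (p l) (weak_div (\<Omega>s l) (q' l))
       + \<alpha> * L2_inner (surface_measure (interface \<Omega>s)) \<nu> \<nu>'
       = L2_inner (lebesgue_on (\<Omega>s l)) (d\<eta> l) (q' l)
         - L2_inner (surface_measure (interface \<Omega>s)) (g l) \<nu>')"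

definition transmission_equation ::
    "(nat \<Rightarrow> 'a::euclidean_space set) \<Rightarrow> real \<Rightarrow>
     (nat \<Rightarrow> 'a \<Rightarrow> 'a) \<Rightarrow> (nat \<Rightarrow> 'a \<Rightarrow> real) \<Rightarrow> (nat \<Rightarrow> 'a \<Rightarrow> real) \<Rightarrow> bool" where
  "transmission_equation \<Omega>s \<alpha> q0 g0 g \<longleftrightarrow>
    (\<forall>g'\<in>G_space \<Omega>s. \<forall>l\<in>{1,2}. \<forall>j\<in>{1,2}. l \<noteq> j \<longrightarrow>
       (\<forall>\<nu>. interface_trace \<Omega>s j (q0 j) \<nu> \<longrightarrow>
         L2_inner (surface_measure (interface \<Omega>s)) (g l) (g' l) =
         L2_inner (surface_measure (interface \<Omega>s)) (\<lambda>x. 2 * \<alpha> * \<nu> x + g0 j x) (g' l)))"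

definition limit_solution ::
    "(nat \<Rightarrow> 'a::euclidean_space set) \<Rightarrow> 'a set \<Rightarrow> (nat \<Rightarrow> real \<Rightarrow> real) \<Rightarrow> (nat \<Rightarrow> real \<Rightarrow> real) \<Rightarrow>
     real \<Rightarrow> real \<Rightarrow> (nat \<Rightarrow> 'a \<Rightarrow> real) \<Rightarrow> (nat \<Rightarrow> 'a \<Rightarrow> 'a) \<Rightarrow> (nat \<Rightarrow> 'a \<Rightarrow> real) \<Rightarrow>
     (nat \<Rightarrow> 'a \<Rightarrow> 'a) \<Rightarrow> (nat \<Rightarrow> 'a \<Rightarrow> real) \<Rightarrow> (nat \<Rightarrow> 'a \<Rightarrow> real) \<Rightarrow> bool" where
  "limit_solution \<Omega>s N k S \<alpha> \<tau> F d\<eta> p_prev q p g \<longleftrightarrow>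
    q \<in> Q_space \<Omega>s N \<and> p \<in> P_space \<Omega>s \<and> g \<in> G_space \<Omega>s \<and>
    flux_equation \<Omega>s N k S \<alpha> d\<eta> p q p g \<and>
    (\<forall>p'\<in>P_space \<Omega>s. \<forall>l\<in>{1,2}.
       L2_inner (lebesgue_on (\<Omega>s l)) (\<lambda>x. S l (p l x)) (p' l)
       + \<tau> * L2_inner (lebesgue_on (\<Omega>s l)) (weak_div (\<Omega>s l) (q l)) (p' l)
       = \<tau> * L2_inner (lebesgue_on (\<Omega>s l)) (F l) (p' l)
         + L2_inner (lebesgue_on (\<Omega>s l)) (\<lambda>x. S l (p_prev l x)) (p' l)) \<and>
    transmission_equation \<Omega>s \<alpha> q g g"

text \<open>One step of the scheme, from the iterate \<open>(q0, p0, g0)\<close> to \<open>(q, p, g)\<close>.\<close>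

definition scheme_step ::
    "(nat \<Rightarrow> 'a::euclidean_space set) \<Rightarrow> 'a set \<Rightarrow> (nat \<Rightarrow> real \<Rightarrow> real) \<Rightarrow> (nat \<Rightarrow> real \<Rightarrow> real) \<Rightarrow>
     (nat \<Rightarrow> real) \<Rightarrow> real \<Rightarrow> real \<Rightarrow>
     (nat \<Rightarrow> 'a \<Rightarrow> real) \<Rightarrow> (nat \<Rightarrow> 'a \<Rightarrow> 'a) \<Rightarrow> (nat \<Rightarrow> 'a \<Rightarrow> real) \<Rightarrow>
     (nat \<Rightarrow> 'a \<Rightarrow> 'a) \<Rightarrow> (nat \<Rightarrow> 'a \<Rightarrow> real) \<Rightarrow> (nat \<Rightarrow> 'a \<Rightarrow> real) \<Rightarrow>
     (nat \<Rightarrow> 'a \<Rightarrow> 'a) \<Rightarrow> (nat \<Rightarrow> 'a \<Rightarrow> real) \<Rightarrow> (nat \<Rightarrow> 'a \<Rightarrow> real) \<Rightarrow> bool" where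
  "scheme_step \<Omega>s N k S L \<alpha> \<tau> F d\<eta> p_prev q0 p0 g0 q p g \<longleftrightarrow>
    q \<in> Q_space \<Omega>s N \<and> p \<in> P_space \<Omega>s \<and> g \<in> G_space \<Omega>s \<and>
    transmission_equation \<Omega>s \<alpha> q0 g0 g \<and>
    flux_equation \<Omega>s N k S \<alpha> d\<eta> p0 q p g \<and>
    (\<forall>p'\<in>P_space \<Omega>s. \<forall>l\<in>{1,2}.
       L l * L2_inner (lebesgue_on (\<Omega>s l)) (p l) (p' l)
       + \<tau> * L2_inner (lebesgue_on (\<Omega>s l)) (weak_div (\<Omega>s l) (q l)) (p' l)
       = \<tau> * L2_inner (lebesgue_on (\<Omega>s l)) (F l) (p' l)
         - L2_inner (lebesgue_on (\<Omega>s l)) (\<lambda>x. S l (p0 l x) - S l (p_prev l x)) (p' l)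
         + L l * L2_inner (lebesgue_on (\<Omega>s l)) (p0 l) (p' l))"

end

theory Submission
  imports Defs
begin

text \<open>
  Write \<open>e\<close> for the error of a quantity at step \<open>i\<close> and \<open>\<delta> = S(p\<^sup>n) - S(p\<^bsup>i-1\<^esup>)\<close>. Testing the flux
  and mass error equations with the flux and pressure errors, the Robin terms become a difference of
  boundary energies, since \<open>4 \<alpha> (\<alpha> \<parallel>e\<^sub>\<nu>\<parallel>\<^sup>2 + \<langle>e\<^sub>g, e\<^sub>\<nu>\<rangle>) = \<parallel>e\<^sub>g + 2 \<alpha> e\<^sub>\<nu>\<parallel>\<^sup>2 - \<parallel>e\<^sub>g\<parallel>\<^sup>2\<close> and
  \<open>e\<^sub>g + 2 \<alpha> e\<^sub>\<nu>\<close> is the next Robin error on the other side. The permeability error costs a multiple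
  of \<open>\<parallel>\<delta>\<parallel>\<^sup>2\<close> that the step size restriction lets the monotonicity of \<open>S\<close> absorb. What is
  left over is \<open>\<tau>\<^sup>2 / (2 L) \<parallel>div e\<^sub>q\<parallel>\<^sup>2\<close>, summed over the subdomains, bounded by the decrease of a
  nonnegative energy, hence tending to zero. Testing with the two fluxes separately avoids linearity
  of traces and weak divergences; the latter enters only at the end, through uniqueness of the weak
  divergence.
\<close>

section \<open>Calculus in \<open>L\<^sup>2\<close>\<close>

lemma L2_measurable: "f \<in> L2 M \<Longrightarrow> f \<in> borel_measurable M"
  by (simp add: L2_def)

lemma L2_integrable_sq: "f \<in> L2 M \<Longrightarrow> integrable M (\<lambda>x. (norm (f x))\<^sup>2)"
  by (simp add: L2_def)

lemma L2_dominated: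
  assumes g: "g \<in> L2 M" and f: "f \<in> borel_measurable M"
    and le: "\<And>x. x \<in> space M \<Longrightarrow> norm (f x) \<le> C * norm (g x)"
  shows "f \<in> L2 M"
proof -
  have "integrable M (\<lambda>x. (norm (f x))\<^sup>2)"
  proof (rule Bochner_Integration.integrable_bound[where f="\<lambda>x. C\<^sup>2 * (norm (g x))\<^sup>2"])
    show "integrable M (\<lambda>x. C\<^sup>2 * (norm (g x))\<^sup>2)"
      using L2_integrable_sq[OF g] by simp
    show "AE x in M. norm ((norm (f x))\<^sup>2) \<le> norm (C\<^sup>2 * (norm (g x))\<^sup>2)"
    proof (rule AE_I2)
      fix x assume "x \<in> space M"
      then have "(norm (f x))\<^sup>2 \<le> (C * norm (g x))\<^sup>2"
        using le by (intro power_mono) auto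
      then show "norm ((norm (f x))\<^sup>2) \<le> norm (C\<^sup>2 * (norm (g x))\<^sup>2)"
        by (simp add: power_mult_distrib)
    qed
  qed (use f in measurable)
  then show ?thesis using f by (simp add: L2_def)
qed

lemma L2_add: 
  assumes f: "f \<in> L2 M" and g: "g \<in> L2 M"
  shows "(\<lambda>x. f x + g x) \<in> L2 M"
proof -
  note [measurable] = L2_measurable[OF f] L2_measurable[OF g]
  have "integrable M (\<lambda>x. (norm (f x + g x))\<^sup>2)"
  proof (rule Bochner_Integration.integrable_bound[where f="\<lambda>x. 2 * (norm (f x))\<^sup>2 + 2 * (norm (g x))\<^sup>2"])
    show "integrable M (\<lambda>x. 2 * (norm (f x))\<^sup>2 + 2 * (norm (g x))\<^sup>2)"
      using L2_integrable_sq[OF f] L2_integrable_sq[OF g] by simp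
    have "(norm (f x + g x))\<^sup>2 \<le> 2 * (norm (f x))\<^sup>2 + 2 * (norm (g x))\<^sup>2" for x
    proof -
      have "(norm (f x + g x))\<^sup>2 \<le> (norm (f x) + norm (g x))\<^sup>2"
        by (intro power_mono norm_triangle_ineq) simp
      also have "\<dots> \<le> 2 * (norm (f x))\<^sup>2 + 2 * (norm (g x))\<^sup>2"
        using sum_squares_bound[of "norm (f x)" "norm (g x)"] by (simp add: power2_sum)
      finally show ?thesis .
    qed
    then show "AE x in M. norm ((norm (f x + g x))\<^sup>2) \<le> norm (2 * (norm (f x))\<^sup>2 + 2 * (norm (g x))\<^sup>2)"
      by simp
  qed measurable
  then show ?thesis by (simp add: L2_def)
qed

lemma L2_scaleR: "f \<in> L2 M \<Longrightarrow> (\<lambda>x. c *\<^sub>R f x) \<in> L2 M"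
  by (rule L2_dominated[where C="\<bar>c\<bar>"]) (auto intro: borel_measurable_scaleR dest: L2_measurable)

lemma L2_diff: "f \<in> L2 M \<Longrightarrow> g \<in> L2 M \<Longrightarrow> (\<lambda>x. f x - g x) \<in> L2 M"
  using L2_add[of f M "\<lambda>x. (-1) *\<^sub>R g x"] L2_scaleR[of g M "-1"] by simp

lemma L2_mult: "f \<in> L2 M \<Longrightarrow> (\<lambda>x. c * f x :: real) \<in> L2 M"
  using L2_scaleR[of f M c] by simp

lemma L2_bounded:
  assumes "finite_measure M" "f \<in> borel_measurable M" "\<And>x. x \<in> space M \<Longrightarrow> norm (f x) \<le> C"
  shows "f \<in> L2 M"
proof (rule L2_dominated[where g="\<lambda>_. 1::real" and C=C])
  show "(\<lambda>_. 1::real) \<in> L2 M"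
    using assms(1) by (simp add: L2_def finite_measure.integrable_const)
qed (use assms in auto)

lemma L2_integrable_inner:
  assumes f: "f \<in> L2 M" and g: "g \<in> L2 M"
  shows "integrable M (\<lambda>x. f x \<bullet> g x)"
proof -
  note [measurable] = L2_measurable[OF f] L2_measurable[OF g]
  show ?thesis
  proof (rule Bochner_Integration.integrable_bound[where f="\<lambda>x. (norm (f x))\<^sup>2 + (norm (g x))\<^sup>2"])
    show "integrable M (\<lambda>x. (norm (f x))\<^sup>2 + (norm (g x))\<^sup>2)"
      using L2_integrable_sq[OF f] L2_integrable_sq[OF g] by simp
    have "\<bar>f x \<bullet> g x\<bar> \<le> (norm (f x))\<^sup>2 + (norm (g x))\<^sup>2" for x
    proof -
      have "\<bar>f x \<bullet> g x\<bar> \<le> norm (f x) * norm (g x)" by (rule Cauchy_Schwarz_ineq2)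
      also have "\<dots> \<le> (norm (f x))\<^sup>2 + (norm (g x))\<^sup>2"
        using sum_squares_bound[of "norm (f x)" "norm (g x)"]
          mult_nonneg_nonneg[OF norm_ge_zero[of "f x"] norm_ge_zero[of "g x"]] by linarith
      finally show ?thesis .
    qed
    then show "AE x in M. norm (f x \<bullet> g x) \<le> norm ((norm (f x))\<^sup>2 + (norm (g x))\<^sup>2)"
      by simp
  qed measurable
qed

lemma L2_inner_commute: "L2_inner M f g = L2_inner M g f"
  by (simp add: L2_inner_def inner_commute)

lemma L2_inner_add_left:
  "f \<in> L2 M \<Longrightarrow> g \<in> L2 M \<Longrightarrow> h \<in> L2 M \<Longrightarrow>
    L2_inner M (\<lambda>x. f x + g x) h = L2_inner M f h + L2_inner M g h"
  by (simp add: L2_inner_def inner_add_left L2_integrable_inner)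

lemma L2_inner_diff_left:
  "f \<in> L2 M \<Longrightarrow> g \<in> L2 M \<Longrightarrow> h \<in> L2 M \<Longrightarrow>
    L2_inner M (\<lambda>x. f x - g x) h = L2_inner M f h - L2_inner M g h"
  by (simp add: L2_inner_def inner_diff_left L2_integrable_inner)

lemma L2_inner_add_right:
  "f \<in> L2 M \<Longrightarrow> g \<in> L2 M \<Longrightarrow> h \<in> L2 M \<Longrightarrow>
    L2_inner M h (\<lambda>x. f x + g x) = L2_inner M h f + L2_inner M h g"
  by (simp add: L2_inner_def inner_add_right L2_integrable_inner)

lemma L2_inner_diff_right:
  "f \<in> L2 M \<Longrightarrow> g \<in> L2 M \<Longrightarrow> h \<in> L2 M \<Longrightarrow>
    L2_inner M h (\<lambda>x. f x - g x) = L2_inner M h f - L2_inner M h g"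
  by (simp add: L2_inner_def inner_diff_right L2_integrable_inner)

lemma L2_inner_mult_left: "L2_inner M (\<lambda>x. c * f x) g = (c::real) * L2_inner M f g"
  by (simp add: L2_inner_def mult.assoc)

lemma L2_inner_mult_right: "L2_inner M g (\<lambda>x. c * f x) = (c::real) * L2_inner M g f"
  by (simp add: L2_inner_def mult.left_commute)

lemmas L2_linear = L2_inner_add_left L2_inner_diff_left L2_inner_add_right L2_inner_diff_right
  L2_inner_mult_left L2_inner_mult_right L2_add L2_diff L2_mult

lemma L2_inner_self_nonneg: "L2_inner M f f \<ge> 0"
  unfolding L2_inner_def by (rule integral_nonneg_AE) simp

lemma L2_norm_sq: "(L2_norm M f)\<^sup>2 = L2_inner M f f"
  using L2_inner_self_nonneg[of M f]
  by (simp add: L2_norm_def L2_inner_def power2_norm_eq_inner)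

text \<open>Testing with \<open>f\<close> and with \<open>g\<close> gives
  \<open><f,f> = <g,f>\<close> and \<open><f,g> = <g,g>\<close>, and symmetry joins the two. The
  transmission condition is known only in weak form; this turns it into an equality of boundary
  energies without passing to pointwise values.\<close>

lemma L2_inner_self_eq_of_weak_eq:
  assumes "f \<in> L2 M" "g \<in> L2 M" "\<And>h. h \<in> L2 M \<Longrightarrow> L2_inner M f h = L2_inner M g h"
  shows "L2_inner M f f = L2_inner M g g"
  using assms(3)[OF assms(1)] assms(3)[OF assms(2)] by (simp add: L2_inner_commute)

section \<open>Smooth bump functions\<close>

text \<open>For \<open>j = 0\<close> this is the classical smooth function that vanishes to infinite
  order at the origin. Differentiation brings out powers of \<open>1 / t\<close>; carrying them as
  the index \<open>j\<close> closes the span of the family under derivatives.\<close>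

definition flat_exp :: "nat \<Rightarrow> real \<Rightarrow> real" where
  "flat_exp j t = (if t > 0 then exp (- (1 / t)) * (1 / t) ^ j else 0)"

text \<open>From the right, the substitution \<open>u = 1 / t\<close> turns the claim into the decay
  of \<open>u ^ j / exp u\<close> at infinity; from the left the function is zero.\<close>

lemma flat_exp_tendsto_0: "(flat_exp j \<longlongrightarrow> 0) (at 0)"
proof -
  have l: "(flat_exp j \<longlongrightarrow> 0) (at_left 0)"
    by (rule tendsto_eventually) (auto simp: flat_exp_def eventually_at_filter)
  have "((\<lambda>t::real. inverse t ^ j / exp (inverse t)) \<longlongrightarrow> 0) (at_right 0)"
    by (rule filterlim_compose[OF tendsto_power_div_exp_0 filterlim_inverse_at_top_right])
  then have "(flat_exp j \<longlongrightarrow> 0) (at_right 0)"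
    by (rule Lim_transform_eventually)
      (auto simp: flat_exp_def eventually_at_filter exp_minus divide_inverse mult.commute)
  with l show ?thesis by (rule filterlim_split_at)
qed

lemma flat_exp_has_derivative:
  "(flat_exp j has_real_derivative flat_exp (j + 2) t - real j * flat_exp (j + 1) t) (at t)"
proof -
  consider "t < 0" | "t = 0" | "t > 0" by linarith
  then show ?thesis
  proof cases
    case 1
    have "((\<lambda>_. 0) has_real_derivative 0) (at t)" by simp
    then have "(flat_exp j has_real_derivative 0) (at t)"
      by (rule DERIV_cong_ev[THEN iffD1, rotated -1])
        (use 1 in \<open>auto simp: flat_exp_def intro!: eventually_mono[OF eventually_nhds_in_open[of "{..<0}"]]\<close>)
    then show ?thesis using 1 by (simp add: flat_exp_def)
  next
    case 2
    \<comment> \<open>Dividing by \<open>h\<close> raises the index: the difference quotient at the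
      origin is \<open>flat_exp (j + 1) h\<close>.\<close>
    have "((\<lambda>h. (flat_exp j (0 + h) - flat_exp j 0) / h) \<longlongrightarrow> 0) (at 0)"
      using flat_exp_tendsto_0[of "j + 1"]
      by (rule Lim_transform_eventually) (auto simp: flat_exp_def eventually_at_filter)
    then show ?thesis using 2 by (simp add: DERIV_def flat_exp_def)
  next
    case 3
    have inv: "((\<lambda>t. 1 / t) has_real_derivative - ((1 / t) * (1 / t))) (at t)"
      using 3 by (auto intro!: derivative_eq_intros)
    have "((\<lambda>t. exp (- (1 / t)) * (1 / t) ^ j) has_real_derivative
        exp (- (1 / t)) * (real j * (- ((1 / t) * (1 / t)) * (1 / t) ^ (j - Suc 0)))
        + (exp (- (1 / t)) * ((1 / t) * (1 / t))) * (1 / t) ^ j) (at t)"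
      using DERIV_mult'[OF DERIV_fun_exp[OF DERIV_minus[OF inv]] DERIV_power[OF inv, of j]] by simp
    \<comment> \<open>The case \<open>j = 0\<close> is split off because \<open>j - Suc 0\<close> is
      truncated there; the factor \<open>real j\<close> then removes the term.\<close>
    moreover have "exp (- u) * (real j * (- (u * u) * u ^ (j - Suc 0))) + (exp (- u) * (u * u)) * u ^ j
        = exp (- u) * u ^ (j + 2) - real j * (exp (- u) * u ^ (j + 1))" for u :: real
      by (cases j) (simp_all add: algebra_simps)
    from this[of "1 / t"]
    have "exp (- (1 / t)) * (real j * (- ((1 / t) * (1 / t)) * (1 / t) ^ (j - Suc 0)))
        + (exp (- (1 / t)) * ((1 / t) * (1 / t))) * (1 / t) ^ j
      = flat_exp (j + 2) t - real j * flat_exp (j + 1) t"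
      using 3 unfolding flat_exp_def by simp
    ultimately have "((\<lambda>t. exp (- (1 / t)) * (1 / t) ^ j) has_real_derivative
        flat_exp (j + 2) t - real j * flat_exp (j + 1) t) (at t)" by simp
    then show ?thesis
      by (rule DERIV_cong_ev[THEN iffD1, rotated -1])
        (use 3 in \<open>auto simp: flat_exp_def intro!: eventually_mono[OF eventually_nhds_in_open[of "{0<..}"]]\<close>)
  qed
qed

text \<open>Smoothness of the bump functions follows because this algebra is closed under partial
  derivatives.\<close>

inductive_set bump_algebra :: "('a::euclidean_space \<Rightarrow> real) set" where
  const: "(\<lambda>_. c) \<in> bump_algebra"
| gen: "(\<lambda>x. flat_exp j (x \<bullet> v + c)) \<in> bump_algebra"
| add: "f \<in> bump_algebra \<Longrightarrow> g \<in> bump_algebra \<Longrightarrow> (\<lambda>x. f x + g x) \<in> bump_algebra"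
| mult: "f \<in> bump_algebra \<Longrightarrow> g \<in> bump_algebra \<Longrightarrow> (\<lambda>x. f x * g x) \<in> bump_algebra"

lemma bump_algebra_derivative:
  "f \<in> bump_algebra \<Longrightarrow>
    \<exists>D. (\<forall>x. (f has_derivative D x) (at x)) \<and> (\<forall>b. (\<lambda>x. D x b) \<in> bump_algebra)"
proof (induction rule: bump_algebra.induct)
  case (const c)
  show ?case by (rule exI[of _ "\<lambda>x b. 0"]) (auto intro: bump_algebra.const)
next
  case (gen j v c)
  let ?D = "\<lambda>x b. (b \<bullet> v) * (flat_exp (j + 2) (x \<bullet> v + c) + (- real j) * flat_exp (j + 1) (x \<bullet> v + c))"
  have "((\<lambda>x. flat_exp j (x \<bullet> v + c)) has_derivative ?D x) (at x)" for x
  proof -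
    have "((\<lambda>x. x \<bullet> v + c) has_derivative (\<lambda>b. b \<bullet> v)) (at x)"
      by (auto intro!: derivative_eq_intros)
    from has_derivative_compose[OF this flat_exp_has_derivative[unfolded has_field_derivative_def]]
    show ?thesis by (simp add: mult.commute)
  qed
  moreover have "(\<lambda>x. ?D x b) \<in> bump_algebra" for b
    by (intro bump_algebra.intros)
  ultimately show ?case by (intro exI[of _ ?D]) blast
next
  case (add f g)
  then obtain D E where "\<And>x. (f has_derivative D x) (at x)" "\<And>b. (\<lambda>x. D x b) \<in> bump_algebra"
    "\<And>x. (g has_derivative E x) (at x)" "\<And>b. (\<lambda>x. E x b) \<in> bump_algebra" by metis
  then show ?case
    by (intro exI[of _ "\<lambda>x b. D x b + E x b"]) (auto intro: has_derivative_add bump_algebra.add)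
next
  case (mult f g)
  then obtain D E where "\<And>x. (f has_derivative D x) (at x)" "\<And>b. (\<lambda>x. D x b) \<in> bump_algebra"
    "\<And>x. (g has_derivative E x) (at x)" "\<And>b. (\<lambda>x. E x b) \<in> bump_algebra" by metis
  then show ?case using mult
    by (intro exI[of _ "\<lambda>x b. f x * E x b + D x b * g x"])
      (intro conjI allI has_derivative_mult bump_algebra.add bump_algebra.mult; simp)
qed

text \<open>Induction on the order of differentiability with \<open>f\<close> arbitrary: each
  partial derivative is again in the algebra, so the induction hypothesis applies to it.\<close>

lemma bump_algebra_smooth:
  assumes "f \<in> bump_algebra" shows "smooth f"
proof -
  have "Ck m f" for m
    using assms
  proof (induction m arbitrary: f)
    case 0
    then obtain D where "\<And>x. (f has_derivative D x) (at x)" using bump_algebra_derivative by metis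
    then show ?case
      by (auto intro!: continuous_at_imp_continuous_on has_derivative_continuous)
  next
    case (Suc m)
    then obtain D where D: "\<And>x. (f has_derivative D x) (at x)" "\<And>b. (\<lambda>x. D x b) \<in> bump_algebra"
      using bump_algebra_derivative by metis
    have "frechet_derivative f (at x) = D x" for x
      using frechet_derivative_at[OF D(1)] by simp
    then show ?case using D Suc.IH by (auto simp: differentiable_def)
  qed
  then show ?thesis by (simp add: smooth_def)
qed

lemma bump_algebra_prod:
  "finite A \<Longrightarrow> (\<And>i. i \<in> A \<Longrightarrow> f i \<in> bump_algebra) \<Longrightarrow> (\<lambda>x. \<Prod>i\<in>A. f i x) \<in> bump_algebra"
  by (induction A rule: finite_induct) (auto intro: bump_algebra.intros)

text \<open>Each coordinate contributes one factor for the face at \<open>a\<close> and one for the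
  face at \<open>b\<close>, written in the form of the generators of \<open>bump_algebra\<close>.
  The steepness \<open>s\<close> drives the bump to the indicator of the open box as it
  grows.\<close>

definition box_bump :: "'a::euclidean_space \<Rightarrow> 'a \<Rightarrow> real \<Rightarrow> 'a \<Rightarrow> real" where
  "box_bump a b s x = (\<Prod>i\<in>Basis. flat_exp 0 (x \<bullet> (s *\<^sub>R i) + (- s * (a \<bullet> i))) *
                                   flat_exp 0 (x \<bullet> (- s *\<^sub>R i) + s * (b \<bullet> i)))"

lemma box_bump_smooth: "smooth (box_bump a b s)"
  unfolding box_bump_def
  by (intro bump_algebra_smooth bump_algebra_prod bump_algebra.intros) auto

lemma box_bump_bounded: "\<bar>box_bump a b s x\<bar> \<le> 1"
proof -
  have "0 \<le> flat_exp 0 t \<and> flat_exp 0 t \<le> 1" for t by (simp add: flat_exp_def)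
  then have "0 \<le> box_bump a b s x \<and> box_bump a b s x \<le> 1"
    unfolding box_bump_def by (intro conjI prod_nonneg prod_le_1) (auto intro!: mult_le_one)
  then show ?thesis by simp
qed

lemma box_bump_outside:
  assumes "s > 0" "x \<notin> box a b" shows "box_bump a b s x = 0"
proof -
  obtain i where i: "i \<in> Basis" "x \<bullet> i \<le> a \<bullet> i \<or> b \<bullet> i \<le> x \<bullet> i"
    using assms(2) by (auto simp: mem_box not_less)
  then have "s * (x \<bullet> i) \<le> s * (a \<bullet> i) \<or> s * (b \<bullet> i) \<le> s * (x \<bullet> i)"
    using assms(1) by auto
  then show ?thesis using i(1) unfolding box_bump_def
    by (intro prod_zero) (auto simp: flat_exp_def intro!: bexI[of _ i])
qed

lemma flat_exp_0_tendsto_1: "d > 0 \<Longrightarrow> (\<lambda>n. flat_exp 0 (real (Suc n) * d)) \<longlonglongrightarrow> 1"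
proof -
  assume d: "d > 0"
  have "(\<lambda>n. exp (- ((1 / d) * inverse (real (Suc n))))) \<longlonglongrightarrow> exp (- ((1 / d) * 0))"
    by (intro tendsto_intros LIMSEQ_inverse_real_of_nat)
  moreover have "flat_exp 0 (real (Suc n) * d) = exp (- ((1 / d) * inverse (real (Suc n))))" for n
    using d by (simp add: flat_exp_def divide_inverse zero_less_mult_iff)
  ultimately show ?thesis by simp
qed

lemma box_bump_tendsto: "(\<lambda>n. box_bump a b (real (Suc n)) x) \<longlonglongrightarrow> indicator (box a b) x"
proof (cases "x \<in> box a b")
  case True
  have *: "box_bump a b s x = (\<Prod>i\<in>Basis. flat_exp 0 (s * (x \<bullet> i - a \<bullet> i)) * flat_exp 0 (s * (b \<bullet> i - x \<bullet> i)))" for s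
    by (simp add: box_bump_def algebra_simps)
  have "(\<lambda>n. box_bump a b (real (Suc n)) x) \<longlonglongrightarrow> (\<Prod>i\<in>(Basis::'a set). 1 * 1)"
    unfolding * using True
    by (intro tendsto_prod tendsto_mult flat_exp_0_tendsto_1) (auto simp: mem_box)
  then show ?thesis using True by simp
next
  case False
  then show ?thesis by (simp add: box_bump_outside)
qed

lemma box_bump_test_function:
  assumes "cbox a b \<subseteq> \<Omega>" "s > 0" shows "box_bump a b s \<in> test_functions \<Omega>"
proof -
  have "{x. box_bump a b s x \<noteq> 0} \<subseteq> cbox a b"
    using box_bump_outside[OF assms(2)] box_subset_cbox by blast
  then have "closure {x. box_bump a b s x \<noteq> 0} \<subseteq> cbox a b"
    by (rule closure_minimal[OF _ closed_cbox])
  then show ?thesis using assms(1) box_bump_smooth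
    by (auto simp: test_functions_def compact_eq_bounded_closed
        intro: bounded_subset[OF bounded_cbox])
qed

section \<open>Square integrability of smooth functions and their gradients on bounded open
  sets\<close>

lemma smooth_continuous: "smooth f \<Longrightarrow> continuous_on UNIV f"
  unfolding smooth_def by (metis Ck.simps(1))

lemma smooth_continuous_grad: "smooth f \<Longrightarrow> continuous_on UNIV (grad f)"
proof -
  assume "smooth f"
  then have "Ck (Suc 0) f" by (auto simp: smooth_def simp del: Ck.simps)
  then have "\<And>b. b \<in> Basis \<Longrightarrow> continuous_on UNIV (\<lambda>x. frechet_derivative f (at x) b)" by simp
  then show ?thesis unfolding grad_def[abs_def] by (intro continuous_intros)
qed

lemma L2_continuous:
  fixes \<Omega> :: "'a::euclidean_space set" and f :: "'a \<Rightarrow> 'b::euclidean_space"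
  assumes "open \<Omega>" "bounded \<Omega>" "continuous_on UNIV f"
  shows "f \<in> L2 (lebesgue_on \<Omega>)"
proof -
  have "bounded (f ` closure \<Omega>)"
    using assms by (intro compact_imp_bounded compact_continuous_image)
      (auto intro: continuous_on_subset)
  then obtain C where "\<And>x. x \<in> \<Omega> \<Longrightarrow> norm (f x) \<le> C"
    by (auto simp: bounded_iff) (meson closure_subset subsetD)
  moreover have "f \<in> borel_measurable (lebesgue_on \<Omega>)"
    using assms by (intro continuous_imp_measurable_on_sets_lebesgue)
      (auto intro: continuous_on_subset)
  moreover have "finite_measure (lebesgue_on \<Omega>)"
    using assms by (simp add: finite_measure_lebesgue_on bounded_set_imp_lmeasurable)
  ultimately show ?thesis by (intro L2_bounded[where C=C]) auto
qed

section \<open>Uniqueness of the weak divergence\<close>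

text \<open>Lebesgue differentiation: almost every value of the function is the limit of its
  averages over shrinking cubes with corner \<open>x\<close>, and these averages vanish once the
  cube lies in the open set.\<close>

lemma AE_zero_of_box_integrals_zero:
  fixes w :: "'a::euclidean_space \<Rightarrow> real"
  assumes "open \<Omega>" and w: "integrable (lebesgue_on \<Omega>) w"
    and zero: "\<And>a b. cbox a b \<subseteq> \<Omega> \<Longrightarrow> (\<integral>x. w x * indicator (box a b) x \<partial>lebesgue_on \<Omega>) = 0"
  shows "AE x in lebesgue_on \<Omega>. w x = 0"
proof -
  have \<Omega>: "\<Omega> \<in> sets lebesgue" using assms(1) by (intro sets_completionI_sets) simp
  \<comment> \<open>Extension by zero, since the differentiation theorem is applied on the whole
    space.\<close>
  define f where "f = (\<lambda>x. if x \<in> \<Omega> then w x else 0)"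
  have f: "integrable lebesgue f"
    using w \<Omega> by (simp add: f_def Lebesgue_Measure.integrable_restrict_UNIV)
  have "f integrable_on cbox a b" for a b
    using integrable_on_lebesgue[OF f] integrable_on_subcbox by blast
  then obtain N where N: "negligible N"
    "\<And>x e. \<lbrakk>x \<notin> N; 0 < e\<rbrakk> \<Longrightarrow> \<exists>d>0. \<forall>h. 0 < h \<and> h < d \<longrightarrow>
         norm (integral (cbox x (x + h *\<^sub>R One)) f /\<^sub>R h ^ DIM('a) - f x) < e"
    using integrable_ccontinuous_explicit by blast
  \<comment> \<open>The hypothesis concerns open boxes and the averages closed ones; the faces have
    measure zero.\<close>
  have cz: "integral (cbox a b) f = 0" if "cbox a b \<subseteq> \<Omega>" for a b
  proof -
    have "(\<lambda>x. w x * indicator (box a b) x) = (\<lambda>x. if x \<in> box a b then w x else 0)"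
      by (auto simp: fun_eq_iff)
    then have "integral\<^sup>L (lebesgue_on (box a b \<inter> \<Omega>)) w = 0"
      using zero[OF that] Lebesgue_Measure.integral_restrict_Int[of "box a b" \<Omega> w] \<Omega> by simp
    moreover have bi: "box a b \<inter> \<Omega> = box a b" using that box_subset_cbox by blast
    moreover have "integrable lebesgue (\<lambda>x. indicator (box a b) x *\<^sub>R w x)"
    proof -
      have "(\<lambda>x. indicator (box a b) x *\<^sub>R f x) = (\<lambda>x. indicator (box a b) x *\<^sub>R w x)"
        using bi by (auto simp: fun_eq_iff f_def indicator_def)
      then show ?thesis
        using integrable_mult_indicator[OF _ f, of "box a b"] by simp
    qed
    then have "integrable (lebesgue_on (box a b)) w" by (simp add: integrable_restrict_space)
    ultimately have "integral (box a b) w = 0"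
      using lebesgue_integral_eq_integral[of "box a b" w] by simp
    then have "integral (cbox a b) w = 0" by (simp add: integral_open_interval)
    moreover have "integral (cbox a b) f = integral (cbox a b) w"
      using that by (intro Henstock_Kurzweil_Integration.integral_cong) (auto simp: f_def)
    ultimately show ?thesis by simp
  qed
  have fz: "f x = 0" if x: "x \<in> \<Omega>" "x \<notin> N" for x
  proof (rule ccontr)
    assume "f x \<noteq> 0"
    \<comment> \<open>With tolerance \<open>norm (f x)\<close>, a vanishing average yields the
      contradiction \<open>norm (f x) < norm (f x)\<close>.\<close>
    then obtain d where d: "d > 0" "\<And>h. 0 < h \<Longrightarrow> h < d \<Longrightarrow>
       norm (integral (cbox x (x + h *\<^sub>R One)) f /\<^sub>R h ^ DIM('a) - f x) < norm (f x)"
      using N(2)[OF x(2), of "norm (f x)"] by auto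
    obtain e where e: "e > 0" "ball x e \<subseteq> \<Omega>"
      using assms(1) x(1) by (auto simp: open_contains_ball)
    \<comment> \<open>The Euclidean norm is at most the sum of the coordinates in absolute value, so
      a side of at most \<open>e / (2 * real DIM('a))\<close> keeps the cube within distance
      \<open>e / 2\<close> of \<open>x\<close>.\<close>
    define h where "h = min (d / 2) (e / (2 * real DIM('a)))"
    have h: "0 < h" "h < d" using d(1) e(1) by (auto simp: h_def)
    have "cbox x (x + h *\<^sub>R One) \<subseteq> ball x e"
    proof
      fix y assume y: "y \<in> cbox x (x + h *\<^sub>R One)"
      have "dist x y \<le> (\<Sum>i\<in>Basis. \<bar>(x - y) \<bullet> i\<bar>)" unfolding dist_norm by (rule norm_le_l1)
      also have "\<dots> \<le> (\<Sum>i\<in>(Basis::'a set). h)"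
        using y by (intro sum_mono) (auto simp: mem_box inner_simps)
      also have "\<dots> = real DIM('a) * h" by simp
      also have "\<dots> \<le> real DIM('a) * (e / (2 * real DIM('a)))"
        by (intro mult_left_mono) (auto simp: h_def)
      also have "\<dots> < e" using e(1) by simp
      finally show "y \<in> ball x e" by simp
    qed
    then have "integral (cbox x (x + h *\<^sub>R One)) f = 0" using cz e(2) by blast
    then show False using d(2)[OF h] by simp
  qed
  have "AE x in lebesgue. x \<in> \<Omega> \<longrightarrow> w x = 0"
  proof (rule AE_I')
    show "N \<in> null_sets lebesgue" using N(1) by (simp add: negligible_iff_null_sets)
    show "{x \<in> space lebesgue. \<not> (x \<in> \<Omega> \<longrightarrow> w x = 0)} \<subseteq> N"
      using fz by (auto simp: f_def)
  qed
  then show ?thesis using \<Omega> by (simp add: AE_restrict_space_iff)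
qed

text \<open>The bumps are test functions bounded by 1 that converge pointwise to box indicators;
  dominated convergence with majorant \<open>\<bar>w\<bar>\<close> carries orthogonality over to the
  boxes.\<close>

lemma AE_zero_of_test_functions:
  fixes w :: "'a::euclidean_space \<Rightarrow> real"
  assumes "open \<Omega>" and w: "integrable (lebesgue_on \<Omega>) w"
    and zero: "\<And>\<phi>. \<phi> \<in> test_functions \<Omega> \<Longrightarrow> L2_inner (lebesgue_on \<Omega>) w \<phi> = 0"
  shows "AE x in lebesgue_on \<Omega>. w x = 0"
proof (rule AE_zero_of_box_integrals_zero[OF assms(1,2)])
  fix a b assume ab: "cbox a b \<subseteq> \<Omega>"
  have m: "box_bump a b s \<in> borel_measurable (lebesgue_on \<Omega>)" for s
    using assms(1) by (intro continuous_imp_measurable_on_sets_lebesgue)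
      (auto intro: continuous_on_subset[OF smooth_continuous[OF box_bump_smooth]])
  note [measurable] = m borel_measurable_integrable[OF w]
  have "(\<lambda>n. \<integral>x. w x * box_bump a b (real (Suc n)) x \<partial>lebesgue_on \<Omega>)
      \<longlonglongrightarrow> (\<integral>x. w x * indicator (box a b) x \<partial>lebesgue_on \<Omega>)"
  proof (rule integral_dominated_convergence[where w="\<lambda>x. \<bar>w x\<bar>"])
    show "integrable (lebesgue_on \<Omega>) (\<lambda>x. \<bar>w x\<bar>)" using w by simp
    show "AE x in lebesgue_on \<Omega>. (\<lambda>n. w x * box_bump a b (real (Suc n)) x)
        \<longlonglongrightarrow> w x * indicator (box a b) x"
      by (intro AE_I2 tendsto_mult_left box_bump_tendsto)
    show "AE x in lebesgue_on \<Omega>. norm (w x * box_bump a b (real (Suc n)) x) \<le> \<bar>w x\<bar>" for n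
      using box_bump_bounded[of a b "real (Suc n)"]
      by (intro AE_I2) (simp add: abs_mult mult_left_le)
    show "(\<lambda>x. w x * indicator (box a b) x) \<in> borel_measurable (lebesgue_on \<Omega>)"
      by (intro borel_measurable_times borel_measurable_integrable[OF w] measurable_restrict_space1
        measurable_completion) simp
  qed measurable
  moreover have "(\<integral>x. w x * box_bump a b (real (Suc n)) x \<partial>lebesgue_on \<Omega>) = 0" for n
    using zero[OF box_bump_test_function[OF ab, of "real (Suc n)"]] by (simp add: L2_inner_def)
  ultimately show "(\<integral>x. w x * indicator (box a b) x \<partial>lebesgue_on \<Omega>) = 0"
    by (simp add: LIMSEQ_const_iff)
qed

lemma L2_integrable:
  fixes f :: "'a \<Rightarrow> real"
  assumes "finite_measure M" "f \<in> L2 M" shows "integrable M f"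
proof -
  have "(\<lambda>_. 1::real) \<in> L2 M" using assms(1) by (intro L2_bounded[where C=1]) auto
  from L2_integrable_inner[OF assms(2) this] show ?thesis by simp
qed

text \<open>The difference of two weak divergences is orthogonal to every test function. Boundedness
  of the domain makes it integrable and puts the test functions in \<open>L2\<close>.\<close>

lemma weak_div_unique:
  assumes \<Omega>: "open \<Omega>" "bounded \<Omega>"
    and "u \<in> L2 (lebesgue_on \<Omega>)" "v \<in> L2 (lebesgue_on \<Omega>)" "has_weak_div \<Omega> q u" "has_weak_div \<Omega> q v"
  shows "AE x in lebesgue_on \<Omega>. u x = v x"
proof -
  have fin: "finite_measure (lebesgue_on \<Omega>)"
    using \<Omega> by (simp add: finite_measure_lebesgue_on bounded_set_imp_lmeasurable)
  have "AE x in lebesgue_on \<Omega>. u x - v x = 0"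
  proof (rule AE_zero_of_test_functions[OF \<Omega>(1)])
    show "integrable (lebesgue_on \<Omega>) (\<lambda>x. u x - v x)"
      by (intro L2_integrable fin L2_diff assms)
    fix \<phi> assume \<phi>: "\<phi> \<in> test_functions \<Omega>"
    then have "\<phi> \<in> L2 (lebesgue_on \<Omega>)"
      by (auto simp: test_functions_def intro: L2_continuous[OF \<Omega>] smooth_continuous)
    then show "L2_inner (lebesgue_on \<Omega>) (\<lambda>x. u x - v x) \<phi> = 0"
      using assms(5,6) \<phi> by (simp add: L2_inner_diff_left assms has_weak_div_def)
  qed
  then show ?thesis by simp
qed

lemma weak_div_props:
  assumes "q \<in> Hdiv \<Omega>"
  shows "weak_div \<Omega> q \<in> L2 (lebesgue_on \<Omega>)" "has_weak_div \<Omega> q (weak_div \<Omega> q)"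
proof -
  have "\<exists>v. v \<in> L2 (lebesgue_on \<Omega>) \<and> has_weak_div \<Omega> q v"
    using assms by (auto simp: Hdiv_def)
  from someI_ex[OF this]
  have "weak_div \<Omega> q \<in> L2 (lebesgue_on \<Omega>) \<and> has_weak_div \<Omega> q (weak_div \<Omega> q)"
    by (simp add: weak_div_def)
  then show "weak_div \<Omega> q \<in> L2 (lebesgue_on \<Omega>)" "has_weak_div \<Omega> q (weak_div \<Omega> q)" by auto
qed

lemma has_weak_div_diff:
  assumes \<Omega>: "open \<Omega>" "bounded \<Omega>" and q: "q \<in> Hdiv \<Omega>" "r \<in> Hdiv \<Omega>"
  shows "has_weak_div \<Omega> (\<lambda>x. q x - r x) (\<lambda>x. weak_div \<Omega> q x - weak_div \<Omega> r x)"
  unfolding has_weak_div_def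
proof
  have L2: "q \<in> L2 (lebesgue_on \<Omega>)" "r \<in> L2 (lebesgue_on \<Omega>)" using q by (auto simp: Hdiv_def)
  fix \<phi> assume \<phi>: "\<phi> \<in> test_functions \<Omega>"
  then have "smooth \<phi>" by (simp add: test_functions_def)
  then have "\<phi> \<in> L2 (lebesgue_on \<Omega>)" "grad \<phi> \<in> L2 (lebesgue_on \<Omega>)"
    by (auto intro: L2_continuous[OF \<Omega>] smooth_continuous smooth_continuous_grad)
  then show "L2_inner (lebesgue_on \<Omega>) (\<lambda>x. q x - r x) (grad \<phi>)
      = - L2_inner (lebesgue_on \<Omega>) (\<lambda>x. weak_div \<Omega> q x - weak_div \<Omega> r x) \<phi>"
    using weak_div_props(2)[OF q(1)] weak_div_props(2)[OF q(2)] \<phi>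
    by (simp add: L2_inner_diff_left L2 weak_div_props q has_weak_div_def)
qed

lemma Hdiv_diff:
  assumes "open \<Omega>" "bounded \<Omega>" "q \<in> Hdiv \<Omega>" "r \<in> Hdiv \<Omega>"
  shows "(\<lambda>x. q x - r x) \<in> Hdiv \<Omega>"
  using has_weak_div_diff[OF assms] L2_diff[OF weak_div_props(1)[OF assms(3)] weak_div_props(1)[OF assms(4)]]
    assms(3,4)
  by (auto simp: Hdiv_def intro: L2_diff)

text \<open>Both sides are weak divergences of the difference, so uniqueness applies. Equality holds
  only almost everywhere because \<open>weak_div\<close> picks an arbitrary representative.\<close>

lemma weak_div_diff:
  assumes "open \<Omega>" "bounded \<Omega>" "q \<in> Hdiv \<Omega>" "r \<in> Hdiv \<Omega>"
  shows "AE x in lebesgue_on \<Omega>. weak_div \<Omega> (\<lambda>x. q x - r x) x = weak_div \<Omega> q x - weak_div \<Omega> r x"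
  by (rule weak_div_unique[OF assms(1,2) _ _ weak_div_props(2) has_weak_div_diff])
    (intro weak_div_props L2_diff Hdiv_diff assms)+

lemma L2_norm_cong_AE:
  "f \<in> borel_measurable M \<Longrightarrow> g \<in> borel_measurable M \<Longrightarrow> AE x in M. f x = g x \<Longrightarrow> L2_norm M f = L2_norm M g"
  unfolding L2_norm_def by (intro arg_cong[where f=sqrt] integral_cong_AE) auto

section \<open>Energy estimate on one subdomain\<close>

text \<open>Splitting \<open>kn qn - k0 q = (kn - k0) qn + k0 (qn - q)\<close>, the second part is
  coercive with constant \<open>m\<close> and the first is at most
  \<open>C \<bar>\<delta>\<bar> B\<close> in norm. Young's inequality absorbs the flux error; its
  constant \<open>1 / (2 * m)\<close> matches the step size restriction.\<close>

lemma L2_inner_coercive_perturbation: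
  fixes qn q :: "'a \<Rightarrow> 'b::euclidean_space" and \<delta> kn k0 :: "'a \<Rightarrow> real"
  assumes L2: "qn \<in> L2 M" "q \<in> L2 M" "\<delta> \<in> L2 M"
      "(\<lambda>x. kn x *\<^sub>R qn x) \<in> L2 M" "(\<lambda>x. k0 x *\<^sub>R q x) \<in> L2 M"
    and m: "0 < m" "\<And>x. m \<le> k0 x"
    and lip: "\<And>x. \<bar>kn x - k0 x\<bar> \<le> C * \<bar>\<delta> x\<bar>" "0 \<le> C"
    and bound: "AE x in M. norm (qn x) \<le> B"
  shows "- (C\<^sup>2 * B\<^sup>2 / (2 * m)) * L2_inner M \<delta> \<delta>
    \<le> L2_inner M (\<lambda>x. kn x *\<^sub>R qn x - k0 x *\<^sub>R q x) (\<lambda>x. qn x - q x)"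
proof -
  have "(\<integral>x. - (C\<^sup>2 * B\<^sup>2 / (2 * m)) * (\<delta> x \<bullet> \<delta> x) \<partial>M)
    \<le> (\<integral>x. (kn x *\<^sub>R qn x - k0 x *\<^sub>R q x) \<bullet> (qn x - q x) \<partial>M)"
  proof (rule integral_mono_AE)
    show "integrable M (\<lambda>x. - (C\<^sup>2 * B\<^sup>2 / (2 * m)) * (\<delta> x \<bullet> \<delta> x))"
      by (intro integrable_mult_right L2_integrable_inner L2)
    show "integrable M (\<lambda>x. (kn x *\<^sub>R qn x - k0 x *\<^sub>R q x) \<bullet> (qn x - q x))"
      by (intro L2_integrable_inner L2_diff L2)
    show "AE x in M. - (C\<^sup>2 * B\<^sup>2 / (2 * m)) * (\<delta> x \<bullet> \<delta> x)
        \<le> (kn x *\<^sub>R qn x - k0 x *\<^sub>R q x) \<bullet> (qn x - q x)"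
      using bound
    proof eventually_elim
      case (elim x)
      define t where "t = norm (qn x - q x)"
      define s where "s = C * \<bar>\<delta> x\<bar> * B"
      have "norm ((kn x - k0 x) *\<^sub>R qn x) \<le> s"
        using mult_mono[OF lip(1) elim, of x] lip(2) by (simp add: s_def)
      from mult_right_mono[OF this norm_ge_zero, of "qn x - q x"]
      have "\<bar>((kn x - k0 x) *\<^sub>R qn x) \<bullet> (qn x - q x)\<bar> \<le> s * t"
        using Cauchy_Schwarz_ineq2[of "(kn x - k0 x) *\<^sub>R qn x" "qn x - q x"]
        unfolding t_def by linarith
      moreover have "m * t\<^sup>2 \<le> k0 x * ((qn x - q x) \<bullet> (qn x - q x))"
        unfolding t_def power2_norm_eq_inner using m(2) by (intro mult_right_mono) auto
      moreover have "(kn x *\<^sub>R qn x - k0 x *\<^sub>R q x) \<bullet> (qn x - q x)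
          = ((kn x - k0 x) *\<^sub>R qn x) \<bullet> (qn x - q x) + k0 x * ((qn x - q x) \<bullet> (qn x - q x))"
        by (simp add: inner_simps algebra_simps)
      ultimately have "m * t\<^sup>2 - s * t \<le> (kn x *\<^sub>R qn x - k0 x *\<^sub>R q x) \<bullet> (qn x - q x)"
        by linarith
      moreover have "- (s\<^sup>2 / (2 * m)) \<le> m * t\<^sup>2 - s * t"
      proof -
        \<comment> \<open>Completed square; the extra \<open>s\<^sup>2\<close> produces the constant
          \<open>1 / (2 * m)\<close>.\<close>
        have "0 \<le> (2 * m * t - s)\<^sup>2 + s\<^sup>2" by simp
        also have "\<dots> = 4 * m * (m * t\<^sup>2 - s * t + s\<^sup>2 / (2 * m))"
          using m(1) by (simp add: power2_eq_square field_simps)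
        finally show ?thesis using m(1) by (simp add: zero_le_mult_iff)
      qed
      moreover have "s\<^sup>2 / (2 * m) = (C\<^sup>2 * B\<^sup>2 / (2 * m)) * (\<delta> x \<bullet> \<delta> x)"
        by (simp add: s_def power_mult_distrib power2_eq_square)
      ultimately show ?case by linarith
    qed
  qed
  then show ?thesis by (simp add: L2_inner_def)
qed

text \<open>The scalars stand for inner products of \<open>d = \<delta>\<close>, the divergence error \<open>E\<close> and the new and old
  pressure errors \<open>p\<close> and \<open>z\<close>. Completing the square leaves \<open>\<parallel>L (p - z) + d\<parallel>\<^sup>2\<close>, which the mass
  balance identifies with \<open>\<tau>\<^sup>2 \<parallel>E\<parallel>\<^sup>2\<close>; keeping it is what yields control of the divergence.\<close>

lemma energy_scalar:
  fixes L \<tau> :: real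
  assumes "L > 0" 
    and E: "dE + \<tau> * EE + L * pE - L * zE = 0"
    and p: "dp + \<tau> * pE + L * pp - L * pz = 0"
    and z: "dz + \<tau> * zE + L * pz - L * zz = 0"
    and d: "dd + \<tau> * dE + L * dp - L * dz = 0"
    and flux: "\<tau> * A - \<tau> * pE + \<tau> * X = 0"
    and low: "c * dd \<le> dz + \<tau> * A" "dd / (2 * L) \<le> c * dd"
  shows "\<tau>\<^sup>2 / (2 * L) * EE + \<tau> * X + L / 2 * pp \<le> L / 2 * zz"
proof -
  \<comment> \<open>The mass balance tested with \<open>d\<close>, \<open>p\<close> and
    \<open>z\<close> eliminates the mixed products with \<open>E\<close> from the balance tested
    with \<open>E\<close> itself.\<close>
  have 1: "\<tau> * dE = L * dz - L * dp - dd" using d by linarith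
  have 2: "\<tau> * pE = L * pz - L * pp - dp" using p by linarith
  have 3: "\<tau> * zE = L * zz - L * pz - dz" using z by linarith
  have "\<tau> * (dE + \<tau> * EE + L * pE - L * zE) = 0" using E by simp
  then have "\<tau>\<^sup>2 * EE = - (\<tau> * dE) - L * (\<tau> * pE) + L * (\<tau> * zE)"
    by (simp add: power2_eq_square algebra_simps)
  also have "\<dots> = 2 * L * (L / 2 * (pp - 2 * pz + zz) + (dp - dz)) + dd"
    unfolding 1 2 3 by (simp add: algebra_simps)
  finally have "\<tau>\<^sup>2 / (2 * L) * EE = L / 2 * (pp - 2 * pz + zz) + (dp - dz) + dd / (2 * L)"
    using assms(1) by (simp add: field_simps)
  moreover have "L / 2 * (pp - 2 * pz + zz) = L / 2 * pp - L * pz + L / 2 * zz"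
    by (simp add: algebra_simps)
  \<comment> \<open>The two lower bounds give \<open>dd / (2 * L) - dz \<le> \<tau> * A\<close>, and
    the flux equation together with \<open>2\<close> rewrites \<open>\<tau> * A\<close> as
    \<open>L * pz - L * pp - dp - \<tau> * X\<close>; the terms in \<open>pz\<close> and
    \<open>dp\<close> cancel.\<close>
  ultimately show ?thesis using 2 flux low by linarith
qed

text \<open>Subdomain and interface enter only as measures \<open>M\<close> and \<open>B\<close>;
  \<open>dn\<close>, \<open>d\<close> stand for divergences and \<open>\<nu>n\<close>,
  \<open>\<nu>\<close> for normal traces. The flux equations are required for just two test triples.
  The data functionals \<open>R\<close> and \<open>Y\<close> may be arbitrary, as they cancel
  between limit and iterate. The boundary term on the left is the Robin error handed to the
  neighbour in the next iteration.\<close>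

lemma subdomain_energy:
  fixes qn q :: "'a \<Rightarrow> 'b::euclidean_space" and M :: "'a measure" and B :: "'c measure"
    and dn d pn p p0 sn s0 kn k0 :: "'a \<Rightarrow> real" and \<nu>n \<nu> gn g :: "'c \<Rightarrow> real"
  assumes L2: "qn \<in> L2 M" "q \<in> L2 M" "dn \<in> L2 M" "d \<in> L2 M" "pn \<in> L2 M" "p \<in> L2 M" "p0 \<in> L2 M"
      "sn \<in> L2 M" "s0 \<in> L2 M" "(\<lambda>x. kn x *\<^sub>R qn x) \<in> L2 M" "(\<lambda>x. k0 x *\<^sub>R q x) \<in> L2 M"
    and L2B: "\<nu>n \<in> L2 B" "\<nu> \<in> L2 B" "gn \<in> L2 B" "g \<in> L2 B"
    and pos: "0 < L" "0 < \<tau>" "0 < \<alpha>" "0 < m" "0 < LS" "0 \<le> C"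
    and k0: "\<And>x. m \<le> k0 x"
    and lip: "\<And>x. \<bar>kn x - k0 x\<bar> \<le> C * \<bar>sn x - s0 x\<bar>"
    and bound: "AE x in M. norm (qn x) \<le> Mq"
    and mono: "\<And>x. (sn x - s0 x)\<^sup>2 / LS \<le> (sn x - s0 x) * (pn x - p0 x)"
    and small: "\<tau> * (C\<^sup>2 * Mq\<^sup>2 / (2 * m)) \<le> 1 / LS - 1 / (2 * L)"
    and flux_n: "\<And>f df \<mu>. (f, df, \<mu>) \<in> {(qn, dn, \<nu>n), (q, d, \<nu>)} \<Longrightarrow>
      L2_inner M (\<lambda>x. kn x *\<^sub>R qn x) f - L2_inner M pn df + \<alpha> * L2_inner B \<nu>n \<mu>
        = R f - L2_inner B gn \<mu>"
    and flux_i: "\<And>f df \<mu>. (f, df, \<mu>) \<in> {(qn, dn, \<nu>n), (q, d, \<nu>)} \<Longrightarrow>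
      L2_inner M (\<lambda>x. k0 x *\<^sub>R q x) f - L2_inner M p df + \<alpha> * L2_inner B \<nu> \<mu>
        = R f - L2_inner B g \<mu>"
    and mass_n: "\<And>f. f \<in> L2 M \<Longrightarrow> L2_inner M sn f + \<tau> * L2_inner M dn f = Y f"
    and mass_i: "\<And>f. f \<in> L2 M \<Longrightarrow>
      L * L2_inner M p f + \<tau> * L2_inner M d f = Y f - L2_inner M s0 f + L * L2_inner M p0 f"
  shows "\<tau>\<^sup>2 / (2 * L) * L2_inner M (\<lambda>x. dn x - d x) (\<lambda>x. dn x - d x)
      + \<tau> / (4 * \<alpha>) * L2_inner B (\<lambda>x. (2 * \<alpha> * \<nu>n x + gn x) - (2 * \<alpha> * \<nu> x + g x))
                                 (\<lambda>x. (2 * \<alpha> * \<nu>n x + gn x) - (2 * \<alpha> * \<nu> x + g x))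
      + L / 2 * L2_inner M (\<lambda>x. pn x - p x) (\<lambda>x. pn x - p x)
    \<le> \<tau> / (4 * \<alpha>) * L2_inner B (\<lambda>x. gn x - g x) (\<lambda>x. gn x - g x)
      + L / 2 * L2_inner M (\<lambda>x. pn x - p0 x) (\<lambda>x. pn x - p0 x)"
proof -
  define eq where "eq = (\<lambda>x. qn x - q x)"
  define E where "E = (\<lambda>x. dn x - d x)"
  define ep where "ep = (\<lambda>x. pn x - p x)"
  define e0 where "e0 = (\<lambda>x. pn x - p0 x)"
  define \<delta> where "\<delta> = (\<lambda>x. sn x - s0 x)"
  define e\<nu> where "e\<nu> = (\<lambda>x. \<nu>n x - \<nu> x)"
  define eg where "eg = (\<lambda>x. gn x - g x)"
  define A where "A = L2_inner M (\<lambda>x. kn x *\<^sub>R qn x - k0 x *\<^sub>R q x) eq"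
  define K where "K = C\<^sup>2 * Mq\<^sup>2 / (2 * m)"
  have errs: "E \<in> L2 M" "ep \<in> L2 M" "e0 \<in> L2 M" "\<delta> \<in> L2 M" "e\<nu> \<in> L2 B" "eg \<in> L2 B"
    unfolding E_def ep_def e0_def \<delta>_def e\<nu>_def eg_def by (intro L2_diff L2 L2B)+
  have mass: "L2_inner M \<delta> f + \<tau> * L2_inner M E f + L * L2_inner M ep f - L * L2_inner M e0 f = 0"
    if "f \<in> L2 M" for f
    using mass_n[OF that] mass_i[OF that]
    by (simp add: \<delta>_def E_def ep_def e0_def L2_inner_diff_left L2 that algebra_simps)
  \<comment> \<open>Both equations are tested with both fluxes; the alternating sum of the four
    identities is the error equation tested with the flux error.\<close>
  have flux: "A - L2_inner M ep E + \<alpha> * L2_inner B e\<nu> e\<nu> + L2_inner B eg e\<nu> = 0"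
    using flux_n[of qn dn \<nu>n] flux_n[of q d \<nu>] flux_i[of qn dn \<nu>n] flux_i[of q d \<nu>]
    by (simp add: A_def eq_def E_def ep_def e\<nu>_def eg_def L2_linear L2 L2B algebra_simps)
  have A: "- K * L2_inner M \<delta> \<delta> \<le> A"
    unfolding A_def K_def eq_def
    by (rule L2_inner_coercive_perturbation)
      (use L2 errs pos k0 lip bound in \<open>auto simp: \<delta>_def\<close>)
  have "(\<integral>x. (1 / LS) * (\<delta> x \<bullet> \<delta> x) \<partial>M) \<le> (\<integral>x. \<delta> x \<bullet> e0 x \<partial>M)"
    using mono by (intro integral_mono integrable_mult_right L2_integrable_inner errs)
      (simp add: \<delta>_def e0_def power2_eq_square)
  then have monoI: "(1 / LS) * L2_inner M \<delta> \<delta> \<le> L2_inner M \<delta> e0"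
    by (simp add: L2_inner_def)
  have bdry: "L2_inner B (\<lambda>x. 2 * \<alpha> * e\<nu> x + eg x) (\<lambda>x. 2 * \<alpha> * e\<nu> x + eg x)
      = L2_inner B eg eg + 4 * \<alpha> * (\<alpha> * L2_inner B e\<nu> e\<nu> + L2_inner B eg e\<nu>)"
  proof -
    define u where "u = (\<lambda>x. 2 * \<alpha> * e\<nu> x)"
    have u: "u \<in> L2 B" unfolding u_def by (rule L2_mult[OF errs(5)])
    have "L2_inner B (\<lambda>x. u x + eg x) (\<lambda>x. u x + eg x)
        = L2_inner B u u + 2 * L2_inner B eg u + L2_inner B eg eg"
      using L2_inner_commute[of B u eg]
      by (simp add: L2_inner_add_left L2_inner_add_right L2_add u errs)
    moreover have "L2_inner B u u = 4 * \<alpha> * (\<alpha> * L2_inner B e\<nu> e\<nu>)"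
      unfolding u_def L2_inner_mult_left L2_inner_mult_right by simp
    moreover have "L2_inner B eg u = 2 * \<alpha> * L2_inner B eg e\<nu>"
      unfolding u_def L2_inner_mult_right by simp
    ultimately show ?thesis unfolding u_def by (simp add: algebra_simps)
  qed
  have eq_bdry: "(\<lambda>x. (2 * \<alpha> * \<nu>n x + gn x) - (2 * \<alpha> * \<nu> x + g x)) = (\<lambda>x. 2 * \<alpha> * e\<nu> x + eg x)"
    by (simp add: e\<nu>_def eg_def algebra_simps)
  have "\<tau>\<^sup>2 / (2 * L) * L2_inner M E E + \<tau> * (\<alpha> * L2_inner B e\<nu> e\<nu> + L2_inner B eg e\<nu>)
      + L / 2 * L2_inner M ep ep \<le> L / 2 * L2_inner M e0 e0"
  \<comment> \<open>The coefficient \<open>c\<close> is the gain \<open>1 / LS\<close> from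
    monotonicity of the saturation minus the loss \<open>\<tau> * K\<close> from the permeability
    error; \<open>small\<close> says that \<open>c\<close> is at least
    \<open>1 / (2 * L)\<close>.\<close>
  proof (rule energy_scalar[where A=A and c="1 / LS - \<tau> * K" and dd="L2_inner M \<delta> \<delta>"
        and dE="L2_inner M \<delta> E" and pE="L2_inner M ep E" and zE="L2_inner M e0 E"
        and dp="L2_inner M \<delta> ep" and pz="L2_inner M e0 ep" and dz="L2_inner M \<delta> e0"])
    show "L > 0" by fact
    show "L2_inner M \<delta> E + \<tau> * L2_inner M E E + L * L2_inner M ep E - L * L2_inner M e0 E = 0"
      by (rule mass[OF errs(1)])
    show "L2_inner M \<delta> ep + \<tau> * L2_inner M ep E + L * L2_inner M ep ep - L * L2_inner M e0 ep = 0"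
      using mass[OF errs(2)] by (simp add: L2_inner_commute[of M E ep])
    show "L2_inner M \<delta> e0 + \<tau> * L2_inner M e0 E + L * L2_inner M e0 ep - L * L2_inner M e0 e0 = 0"
      using mass[OF errs(3)] by (simp add: L2_inner_commute[of M E e0] L2_inner_commute[of M ep e0])
    show "L2_inner M \<delta> \<delta> + \<tau> * L2_inner M \<delta> E + L * L2_inner M \<delta> ep - L * L2_inner M \<delta> e0 = 0"
      using mass[OF errs(4)] by (simp add: L2_inner_commute[of M E \<delta>] L2_inner_commute[of M ep \<delta>] L2_inner_commute[of M e0 \<delta>])
    have "\<tau> * (A - L2_inner M ep E + \<alpha> * L2_inner B e\<nu> e\<nu> + L2_inner B eg e\<nu>) = 0"
      using flux by simp
    then show "\<tau> * A - \<tau> * L2_inner M ep E + \<tau> * (\<alpha> * L2_inner B e\<nu> e\<nu> + L2_inner B eg e\<nu>) = 0"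
      by (simp add: algebra_simps)
    show "(1 / LS - \<tau> * K) * L2_inner M \<delta> \<delta> \<le> L2_inner M \<delta> e0 + \<tau> * A"
      using monoI mult_left_mono[OF A, of \<tau>] pos(2) by (simp add: algebra_simps)
    have "1 / (2 * L) \<le> 1 / LS - \<tau> * K" using small by (simp add: K_def)
    from mult_right_mono[OF this L2_inner_self_nonneg]
    show "L2_inner M \<delta> \<delta> / (2 * L) \<le> (1 / LS - \<tau> * K) * L2_inner M \<delta> \<delta>" by simp
  qed
  moreover have "\<tau> / (4 * \<alpha>) * (L2_inner B eg eg + 4 * \<alpha> * (\<alpha> * L2_inner B e\<nu> e\<nu> + L2_inner B eg e\<nu>))
      = \<tau> / (4 * \<alpha>) * L2_inner B eg eg + \<tau> * (\<alpha> * L2_inner B e\<nu> e\<nu> + L2_inner B eg e\<nu>)"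
    using pos(3) by (simp add: field_simps)
  ultimately show ?thesis
    unfolding eq_bdry bdry E_def[symmetric] ep_def[symmetric] e0_def[symmetric] eg_def[symmetric]
    by linarith
qed

section \<open>Convergence\<close>

lemma transmission_equation_tested:
  assumes "transmission_equation \<Omega>s \<alpha> q0 g0 g" "f \<in> L2 (surface_measure (interface \<Omega>s))"
    "l \<in> {1,2}" "j \<in> {1,2}" "l \<noteq> j" "interface_trace \<Omega>s j (q0 j) \<nu>"
  shows "L2_inner (surface_measure (interface \<Omega>s)) (g l) f
    = L2_inner (surface_measure (interface \<Omega>s)) (\<lambda>x. 2 * \<alpha> * \<nu> x + g0 j x) f"
proof -
  have "(\<lambda>_. f) \<in> G_space \<Omega>s" using assms(2) by (simp add: G_space_def)
  from bspec[OF assms(1)[unfolded transmission_equation_def] this] show ?thesis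
    using assms(3-6) by metis
qed

theorem theorem3p6:
  fixes \<Omega> D N :: "'a::euclidean_space set"
    and \<Omega>s :: "nat \<Rightarrow> 'a set"
    and \<tau> \<alpha> :: real
    and L L_S m_k M_k m_kbar M_kbar L_kbar M_q :: "nat \<Rightarrow> real"
    and k S :: "nat \<Rightarrow> real \<Rightarrow> real"
    and F \<eta> p_prev pn gn :: "nat \<Rightarrow> 'a \<Rightarrow> real"
    and d\<eta> qn :: "nat \<Rightarrow> 'a \<Rightarrow> 'a"
    and p g :: "nat \<Rightarrow> nat \<Rightarrow> 'a \<Rightarrow> real"
    and q :: "nat \<Rightarrow> nat \<Rightarrow> 'a \<Rightarrow> 'a"
  assumes dim: "DIM('a) \<in> {2, 3}"
    and geometry: "two_domain_geometry \<Omega> D N \<Omega>s"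
    and tau_pos: "\<tau> > 0"
    and L_pos: "\<And>l. l \<in> {1,2} \<Longrightarrow> L l > 0"
    and source: "\<And>l. l \<in> {1,2} \<Longrightarrow> F l \<in> L2 (lebesgue_on (\<Omega>s l))"
    and eta: "\<And>l. l \<in> {1,2} \<Longrightarrow>
      has_weak_grad (\<Omega>s l) (\<eta> l) (d\<eta> l) \<and> d\<eta> l \<in> L2 (lebesgue_on (\<Omega>s l))"
    and previous: "p_prev \<in> P_space \<Omega>s"
    \<comment> \<open>(i)\<close>
    and k_bounds: "\<And>l. l \<in> {1,2} \<Longrightarrow> 0 < m_k l \<and> m_k l \<le> M_k l \<and> k l ` {0..1} \<subseteq> {m_k l..M_k l}"
    and k_lipschitz: "\<And>l. l \<in> {1,2} \<Longrightarrow> \<exists>C. C-lipschitz_on {0..1} (k l)"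
    and kbar_bounds: "\<And>l. l \<in> {1,2} \<Longrightarrow> 0 < m_kbar l \<and> m_kbar l \<le> M_kbar l \<and>
      (\<lambda>s. 1 / k l s) ` {0..1} \<subseteq> {m_kbar l..M_kbar l}"
    and kbar_lipschitz: "\<And>l. l \<in> {1,2} \<Longrightarrow>
      L_kbar l > 0 \<and> (L_kbar l)-lipschitz_on {0..1} (\<lambda>s. 1 / k l s)"
    \<comment> \<open>(ii)\<close>
    and S_range: "\<And>l. l \<in> {1,2} \<Longrightarrow> range (S l) \<subseteq> {0..1}"
    and S_mono: "\<And>l. l \<in> {1,2} \<Longrightarrow> mono (S l)"
    and S_lipschitz: "\<And>l. l \<in> {1,2} \<Longrightarrow> L_S l > 0 \<and> (L_S l)-lipschitz_on UNIV (S l)"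
    \<comment> \<open>(iii)\<close>
    and limit: "limit_solution \<Omega>s N k S \<alpha> \<tau> F d\<eta> p_prev qn pn gn"
    and flux_bound: "\<And>l. l \<in> {1,2} \<Longrightarrow> M_q l > 0 \<and>
      esssup (lebesgue_on (\<Omega>s l)) (\<lambda>x. ereal (norm (qn l x))) \<le> ereal (M_q l)"
    \<comment> \<open>(iv)\<close>
    and L_large: "\<And>l. l \<in> {1,2} \<Longrightarrow> L l > L_S l / 2"
    and alpha_pos: "\<alpha> > 0"
    and tau_small: "\<And>l. l \<in> {1,2} \<Longrightarrow>
      \<tau> < (1 / L_S l - 1 / (2 * L l)) * (2 * m_kbar l / ((L_kbar l)\<^sup>2 * (M_q l)\<^sup>2))"
    \<comment> \<open>iterates\<close>
    and initial: "q 0 \<in> Q_space \<Omega>s N" "p 0 \<in> P_space \<Omega>s" "g 0 \<in> G_space \<Omega>s"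
    and scheme: "\<And>i. i \<ge> 1 \<Longrightarrow>
      scheme_step \<Omega>s N k S L \<alpha> \<tau> F d\<eta> p_prev
        (q (i - 1)) (p (i - 1)) (g (i - 1)) (q i) (p i) (g i)"
  shows "(\<lambda>i. broken_norm \<Omega>s (\<lambda>l. weak_div (\<Omega>s l) (\<lambda>x. qn l x - q i l x))) \<longlonglongrightarrow> 0"
proof -

  \<comment> \<open>Membership in the function spaces and choice of trace representatives\<close>
  let ?M = "\<lambda>l. lebesgue_on (\<Omega>s l)"
  let ?B = "surface_measure (interface \<Omega>s)"
  let ?W = "\<lambda>l. weak_div (\<Omega>s l)"
  define kb where "kb = (\<lambda>l x. 1 / k l (S l x))"
  have dom: "open (\<Omega>s l)" "bounded (\<Omega>s l)" if "l \<in> {1,2}" for l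
    using geometry that unfolding two_domain_geometry_def lipschitz_domain_def by blast+
  have fin: "finite_measure (?M l)" if "l \<in> {1,2}" for l
    using dom[OF that] by (simp add: finite_measure_lebesgue_on bounded_set_imp_lmeasurable)
  \<comment> \<open>Indexing by \<open>Suc i\<close> removes the truncated \<open>i - 1\<close>, so
    each step leads from \<open>i\<close> to \<open>Suc i\<close>.\<close>
  have step: "scheme_step \<Omega>s N k S L \<alpha> \<tau> F d\<eta> p_prev (q i) (p i) (g i) (q (Suc i)) (p (Suc i)) (g (Suc i))"
    for i using scheme[of "Suc i"] by simp
  have spaces: "q i \<in> Q_space \<Omega>s N" "p i \<in> P_space \<Omega>s" "g i \<in> G_space \<Omega>s" for i
    using initial step by (cases i; auto simp: scheme_step_def)+
  have spaces_n: "qn \<in> Q_space \<Omega>s N" "pn \<in> P_space \<Omega>s" "gn \<in> G_space \<Omega>s"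
    using limit by (auto simp: limit_solution_def)
  have PL2: "u l \<in> L2 (?M l)" if "u \<in> P_space \<Omega>s" "l \<in> {1,2}" for u l
    using that by (auto simp: P_space_def)
  have GL2: "u l \<in> L2 ?B" if "u \<in> G_space \<Omega>s" "l \<in> {1,2}" for u l
    using that by (auto simp: G_space_def)
  have QH: "u l \<in> Hdiv (\<Omega>s l)" "\<exists>\<nu>. interface_trace \<Omega>s l (u l) \<nu>"
    if "u \<in> Q_space \<Omega>s N" "l \<in> {1,2}" for u l
    using that by (auto simp: Q_space_def Q_local_def)
  have QL2: "u l \<in> L2 (?M l)" if "u \<in> Q_space \<Omega>s N" "l \<in> {1,2}" for u l
    using QH(1)[OF that] by (simp add: Hdiv_def)
  have WL2: "?W l (u l) \<in> L2 (?M l)" if "u \<in> Q_space \<Omega>s N" "l \<in> {1,2}" for u l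
    by (rule weak_div_props QH that)+
  \<comment> \<open>One representative of the trace is fixed for each flux; the equations hold for
    every representative.\<close>
  define tr where "tr = (\<lambda>u l. SOME \<nu>. interface_trace \<Omega>s l (u l) \<nu>)"
  have tr: "interface_trace \<Omega>s l (u l) (tr u l)" if "u \<in> Q_space \<Omega>s N" "l \<in> {1,2}" for u l
    unfolding tr_def by (rule someI_ex[OF QH(2)[OF that]])
  have trL2: "tr u l \<in> L2 ?B" if "u \<in> Q_space \<Omega>s N" "l \<in> {1,2}" for u l
    using tr[OF that] by (simp add: interface_trace_def)

  \<comment> \<open>Bounds, continuity and measurability of the saturation and the inverse
    permeability\<close>
  have S_in: "S l x \<in> {0..1}" if "l \<in> {1,2}" for l x
    by (rule subsetD[OF S_range[OF that] rangeI])
  have S_diff: "\<bar>S l x - S l y\<bar> \<le> L_S l * \<bar>x - y\<bar>" if "l \<in> {1,2}" for l x y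
    using S_lipschitz[OF that] by (auto simp: lipschitz_on_def dist_real_def)
  have kb_in: "m_kbar l \<le> kb l x" "kb l x \<le> M_kbar l" "m_kbar l > 0" if "l \<in> {1,2}" for l x
    using kbar_bounds[OF that] S_in[OF that, of x] by (auto simp: kb_def image_subset_iff)
  have kb_diff: "\<bar>kb l x - kb l y\<bar> \<le> L_kbar l * \<bar>S l x - S l y\<bar>" if "l \<in> {1,2}" for l x y
    using kbar_lipschitz[OF that] S_in[OF that] unfolding kb_def lipschitz_on_def dist_real_def by blast
  have S_cont: "continuous_on UNIV (S l)" if "l \<in> {1,2}" for l
    using S_lipschitz[OF that] lipschitz_on_continuous_on by blast
  \<comment> \<open>Regularity of \<open>1 / k\<close> is given on the unit interval only, which
    suffices since \<open>S\<close> takes its values there. Continuity yields measurability after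
    composition with a pressure.\<close>
  have kb_cont: "continuous_on UNIV (kb l)" if "l \<in> {1,2}" for l
  proof -
    have "continuous_on {0..1} (\<lambda>s. 1 / k l s)"
      using kbar_lipschitz[OF that] lipschitz_on_continuous_on by blast
    from continuous_on_compose2[OF this S_cont[OF that] S_range[OF that]]
    show ?thesis by (simp add: kb_def)
  qed
  have SL2: "(\<lambda>x. S l (u l x)) \<in> L2 (?M l)" if "u \<in> P_space \<Omega>s" "l \<in> {1,2}" for u l
  proof (rule L2_bounded[OF fin[OF that(2)], where C=1])
    show "(\<lambda>x. S l (u l x)) \<in> borel_measurable (?M l)"
      by (rule measurable_compose[OF L2_measurable[OF PL2[OF that]]
            borel_measurable_continuous_onI[OF S_cont[OF that(2)]]])
  qed (use S_in[OF that(2)] in auto)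
  have kbL2: "(\<lambda>x. kb l (u l x) *\<^sub>R v l x) \<in> L2 (?M l)"
    if "u \<in> P_space \<Omega>s" "v \<in> Q_space \<Omega>s N" "l \<in> {1,2}" for u v l
  proof (rule L2_dominated[OF QL2[OF that(2,3)], where C="M_kbar l"])
    show "(\<lambda>x. kb l (u l x) *\<^sub>R v l x) \<in> borel_measurable (?M l)"
      by (intro borel_measurable_scaleR L2_measurable[OF QL2[OF that(2,3)]]
          measurable_compose[OF L2_measurable[OF PL2[OF that(1,3)]]
            borel_measurable_continuous_onI[OF kb_cont[OF that(3)]]])
    show "norm (kb l (u l x) *\<^sub>R v l x) \<le> M_kbar l * norm (v l x)" for x
      using kb_in(1,2)[OF that(3), of "u l x"] kb_in(3)[OF that(3)] by (auto intro: mult_right_mono)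
  qed

  \<comment> \<open>The equations tested on a single subdomain\<close>
  have local_P: "\<exists>f'\<in>P_space \<Omega>s. f' l = f" if "f \<in> L2 (?M l)" for f l
  \<comment> \<open>Test functions come as families over the subdomains; a function on one of them
    is completed by zero on the others.\<close>
  proof (intro bexI[of _ "\<lambda>j. if j = l then f else (\<lambda>_. 0)"])
    have "(\<lambda>_. 0::real) \<in> L2 (?M j)" for j by (simp add: L2_def)
    then show "(\<lambda>j. if j = l then f else (\<lambda>_. 0)) \<in> P_space \<Omega>s" using that by (auto simp: P_space_def)
  qed simp
  have flux_n: "L2_inner (?M l) (\<lambda>x. kb l (pn l x) *\<^sub>R qn l x) (v l) - L2_inner (?M l) (pn l) (?W l (v l))
      + \<alpha> * L2_inner ?B (tr qn l) (tr v l) = L2_inner (?M l) (d\<eta> l) (v l) - L2_inner ?B (gn l) (tr v l)"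
    if "v \<in> Q_space \<Omega>s N" "l \<in> {1,2}" for v l
    using limit tr[OF that] tr[OF spaces_n(1) that(2)] that
    unfolding limit_solution_def flux_equation_def kb_def by blast
  have flux_i: "L2_inner (?M l) (\<lambda>x. kb l (p i l x) *\<^sub>R q (Suc i) l x) (v l)
        - L2_inner (?M l) (p (Suc i) l) (?W l (v l))
      + \<alpha> * L2_inner ?B (tr (q (Suc i)) l) (tr v l)
      = L2_inner (?M l) (d\<eta> l) (v l) - L2_inner ?B (g (Suc i) l) (tr v l)"
    if "v \<in> Q_space \<Omega>s N" "l \<in> {1,2}" for v l i
    using step[of i] tr[OF that] tr[OF spaces(1) that(2)] that
    unfolding scheme_step_def flux_equation_def kb_def by blast
  define Y where "Y = (\<lambda>l f. \<tau> * L2_inner (?M l) (F l) f + L2_inner (?M l) (\<lambda>x. S l (p_prev l x)) f)"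
  have mass_n: "L2_inner (?M l) (\<lambda>x. S l (pn l x)) f + \<tau> * L2_inner (?M l) (?W l (qn l)) f = Y l f"
    if "f \<in> L2 (?M l)" "l \<in> {1,2}" for f l
    using limit local_P[OF that(1)] that(2) unfolding limit_solution_def Y_def by metis
  have mass_i: "L l * L2_inner (?M l) (p (Suc i) l) f + \<tau> * L2_inner (?M l) (?W l (q (Suc i) l)) f
      = Y l f - L2_inner (?M l) (\<lambda>x. S l (p i l x)) f + L l * L2_inner (?M l) (p i l) f"
    if f: "f \<in> L2 (?M l)" and l: "l \<in> {1,2}" for f l i
  proof -
    obtain f' where "f' \<in> P_space \<Omega>s" "f' l = f" using local_P[OF f] by blast
    then have "L l * L2_inner (?M l) (p (Suc i) l) f + \<tau> * L2_inner (?M l) (?W l (q (Suc i) l)) f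
      = \<tau> * L2_inner (?M l) (F l) f - L2_inner (?M l) (\<lambda>x. S l (p i l x) - S l (p_prev l x)) f
        + L l * L2_inner (?M l) (p i l) f"
      using step[of i] l unfolding scheme_step_def by blast
    then show ?thesis
      by (simp add: Y_def L2_inner_diff_left[OF SL2[OF spaces(2) l] SL2[OF previous l] f])
  qed

  \<comment> \<open>Exchange of the Robin data across the interface\<close>
  define h where "h = (\<lambda>j i x. (2 * \<alpha> * tr qn j x + gn j x) - (2 * \<alpha> * tr (q i) j x + g i j x))"
  have robin: "L2_inner ?B (\<lambda>x. gn l x - g (Suc i) l x) (\<lambda>x. gn l x - g (Suc i) l x)
      = L2_inner ?B (h j i) (h j i)" if l: "l \<in> {1,2}" and j: "j \<in> {1,2}" and "l \<noteq> j" for l j i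
  \<comment> \<open>Subtracting the two transmission conditions shows that the new Robin error on
    side \<open>l\<close> is weakly equal to \<open>h j i\<close>, the error sent from the other
    side.\<close>
  proof (rule L2_inner_self_eq_of_weak_eq)
    have n: "(\<lambda>x. 2 * \<alpha> * tr qn j x + gn j x) \<in> L2 ?B"
      by (intro L2_add L2_mult trL2 GL2 spaces_n j)
    have i: "(\<lambda>x. 2 * \<alpha> * tr (q i) j x + g i j x) \<in> L2 ?B"
      by (intro L2_add L2_mult trL2 GL2 spaces j)
    show "(\<lambda>x. gn l x - g (Suc i) l x) \<in> L2 ?B" by (intro L2_diff GL2 spaces spaces_n l)
    show "h j i \<in> L2 ?B" unfolding h_def by (intro L2_diff n i)
    fix f :: "'a \<Rightarrow> real" assume f: "f \<in> L2 ?B"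
    have te_n: "transmission_equation \<Omega>s \<alpha> qn gn gn" using limit by (simp add: limit_solution_def)
    have te_i: "transmission_equation \<Omega>s \<alpha> (q i) (g i) (g (Suc i))"
      using step[of i] by (simp add: scheme_step_def)
    have "L2_inner ?B (gn l) f = L2_inner ?B (\<lambda>x. 2 * \<alpha> * tr qn j x + gn j x) f"
      using transmission_equation_tested[OF te_n f l j \<open>l \<noteq> j\<close> tr[OF spaces_n(1) j]] .
    moreover have "L2_inner ?B (g (Suc i) l) f = L2_inner ?B (\<lambda>x. 2 * \<alpha> * tr (q i) j x + g i j x) f"
      using transmission_equation_tested[OF te_i f l j \<open>l \<noteq> j\<close> tr[OF spaces(1) j]] .
    ultimately show "L2_inner ?B (\<lambda>x. gn l x - g (Suc i) l x) f = L2_inner ?B (h j i) f"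
      unfolding h_def by (simp add: L2_inner_diff_left n i f GL2[OF spaces_n(3) l] GL2[OF spaces(3) l])
  qed

  \<comment> \<open>Decrease of the total energy\<close>
  define D where "D = (\<lambda>i l. L2_inner (?M l) (\<lambda>x. ?W l (qn l) x - ?W l (q i l) x)
      (\<lambda>x. ?W l (qn l) x - ?W l (q i l) x))"
  define G where "G = (\<lambda>i l. \<tau> / (4 * \<alpha>) * L2_inner ?B (\<lambda>x. gn l x - g i l x) (\<lambda>x. gn l x - g i l x))"
  define P where "P = (\<lambda>i l. L l / 2 * L2_inner (?M l) (\<lambda>x. pn l x - p i l x) (\<lambda>x. pn l x - p i l x))"
  \<comment> \<open>The indices differ because \<open>g (Suc i)\<close> is computed from iterate
    \<open>i\<close> alone, before the flux and pressure of step \<open>Suc i\<close>: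
    \<open>G (Suc i)\<close> and \<open>P i\<close> together are the errors that this step starts
    from.\<close>
  define En where "En = (\<lambda>i. \<Sum>l\<in>{1,2}. G (Suc i) l + P i l)"
  have energy: "\<tau>\<^sup>2 / (2 * L l) * D (Suc i) l + \<tau> / (4 * \<alpha>) * L2_inner ?B (h l (Suc i)) (h l (Suc i))
      + P (Suc i) l \<le> G (Suc i) l + P i l" if l: "l \<in> {1,2}" for i l
    unfolding D_def G_def P_def h_def
  proof (rule subdomain_energy[where kn="\<lambda>x. kb l (pn l x)" and ?k0.0="\<lambda>x. kb l (p i l x)"
        and sn="\<lambda>x. S l (pn l x)" and ?s0.0="\<lambda>x. S l (p i l x)" and LS="L_S l" and C="L_kbar l"
        and m="m_kbar l" and Mq="M_q l" and qn="qn l" and q="q (Suc i) l" and Y="Y l"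
        and R="L2_inner (?M l) (d\<eta> l)"])
    show "qn l \<in> L2 (?M l)" "?W l (qn l) \<in> L2 (?M l)" "tr qn l \<in> L2 ?B"
      by (rule QL2[OF spaces_n(1) l] WL2[OF spaces_n(1) l] trL2[OF spaces_n(1) l])+
    show "q (Suc i) l \<in> L2 (?M l)" "?W l (q (Suc i) l) \<in> L2 (?M l)" "tr (q (Suc i)) l \<in> L2 ?B"
      by (rule QL2[OF spaces(1) l] WL2[OF spaces(1) l] trL2[OF spaces(1) l])+
    show "pn l \<in> L2 (?M l)" "p (Suc i) l \<in> L2 (?M l)" "p i l \<in> L2 (?M l)"
      by (rule PL2[OF spaces_n(2) l] PL2[OF spaces(2) l])+
    show "(\<lambda>x. S l (pn l x)) \<in> L2 (?M l)" "(\<lambda>x. S l (p i l x)) \<in> L2 (?M l)"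
      by (rule SL2[OF spaces_n(2) l] SL2[OF spaces(2) l])+
    show "(\<lambda>x. kb l (pn l x) *\<^sub>R qn l x) \<in> L2 (?M l)"
      by (rule kbL2[OF spaces_n(2) spaces_n(1) l])
    show "(\<lambda>x. kb l (p i l x) *\<^sub>R q (Suc i) l x) \<in> L2 (?M l)"
      by (rule kbL2[OF spaces(2) spaces(1) l])
    show "gn l \<in> L2 ?B" "g (Suc i) l \<in> L2 ?B"
      by (rule GL2[OF spaces_n(3) l] GL2[OF spaces(3) l])+
    show "L2_inner (?M l) (\<lambda>x. S l (pn l x)) f + \<tau> * L2_inner (?M l) (?W l (qn l)) f = Y l f"
      if "f \<in> L2 (?M l)" for f by (rule mass_n[OF that l])
    show "L l * L2_inner (?M l) (p (Suc i) l) f + \<tau> * L2_inner (?M l) (?W l (q (Suc i) l)) f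
      = Y l f - L2_inner (?M l) (\<lambda>x. S l (p i l x)) f + L l * L2_inner (?M l) (p i l) f"
      if "f \<in> L2 (?M l)" for f by (rule mass_i[OF that l])
    show "0 < L l" "0 < \<tau>" "0 < \<alpha>" by (fact L_pos[OF l] tau_pos alpha_pos)+
    show "0 < m_kbar l" using kb_in[OF l] by blast
    show "0 < L_S l" using S_lipschitz[OF l] by blast
    show "0 \<le> L_kbar l" using kbar_lipschitz[OF l] by simp
    show "m_kbar l \<le> kb l (p i l x)" for x using kb_in[OF l] by blast
    show "\<bar>kb l (pn l x) - kb l (p i l x)\<bar> \<le> L_kbar l * \<bar>S l (pn l x) - S l (p i l x)\<bar>" for x
      by (rule kb_diff[OF l])
    show "AE x in ?M l. norm (qn l x) \<le> M_q l"
      using esssup_AE[where M="?M l" and f="\<lambda>x. ereal (norm (qn l x))"]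
    proof eventually_elim
      case (elim x)
      from order_trans[OF this conjunct2[OF flux_bound[OF l]]] show ?case by simp
    qed
    show "(S l (pn l x) - S l (p i l x))\<^sup>2 / L_S l
        \<le> (S l (pn l x) - S l (p i l x)) * (pn l x - p i l x)" for x
    proof -
      let ?a = "S l (pn l x) - S l (p i l x)" and ?b = "pn l x - p i l x"
      have LS: "0 < L_S l" using S_lipschitz[OF l] by blast
      have "0 \<le> ?a * ?b"
      proof (cases "pn l x \<le> p i l x")
        case True
        with monoD[OF S_mono[OF l], of "pn l x" "p i l x"] show ?thesis
          by (intro mult_nonpos_nonpos) auto
      next
        case False
        with monoD[OF S_mono[OF l], of "p i l x" "pn l x"] show ?thesis
          by (intro mult_nonneg_nonneg) auto
      qed
      \<comment> \<open>By monotonicity both increments have the same sign, so the Lipschitz bound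
        on \<open>\<bar>?a\<bar>\<close> can be inserted into the product itself.\<close>
      then have "?a * ?b = \<bar>?a\<bar> * \<bar>?b\<bar>" by (metis abs_mult abs_of_nonneg)
      moreover have "\<bar>?a\<bar> * \<bar>?a\<bar> \<le> \<bar>?a\<bar> * (L_S l * \<bar>?b\<bar>)"
        by (intro mult_left_mono S_diff l) simp
      ultimately have "?a\<^sup>2 \<le> L_S l * (?a * ?b)" by (simp add: power2_eq_square mult.left_commute)
      then show ?thesis using LS by (simp add: divide_le_eq mult.commute)
    qed
    show "\<tau> * ((L_kbar l)\<^sup>2 * (M_q l)\<^sup>2 / (2 * m_kbar l)) \<le> 1 / L_S l - 1 / (2 * L l)"
    proof -
      \<comment> \<open>The reciprocal of the last factor in the step size restriction; its
        positivity turns the quotient bound into the product form required.\<close>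
      define c where "c = (L_kbar l)\<^sup>2 * (M_q l)\<^sup>2 / (2 * m_kbar l)"
      have "c > 0" using kbar_lipschitz[OF l] flux_bound[OF l] kb_in[OF l] by (simp add: c_def)
      moreover have "\<tau> < (1 / L_S l - 1 / (2 * L l)) / c" using tau_small[OF l] by (simp add: c_def)
      ultimately show ?thesis unfolding c_def[symmetric] by (simp add: less_divide_eq less_imp_le)
    qed
    fix f df \<mu> assume "(f, df, \<mu>) \<in> {(qn l, ?W l (qn l), tr qn l), (q (Suc i) l, ?W l (q (Suc i) l), tr (q (Suc i)) l)}"
    then obtain v where v: "v \<in> Q_space \<Omega>s N" "f = v l" "df = ?W l (v l)" "\<mu> = tr v l"
      using spaces_n(1) spaces(1) by auto
    show "L2_inner (?M l) (\<lambda>x. kb l (pn l x) *\<^sub>R qn l x) f - L2_inner (?M l) (pn l) df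
      + \<alpha> * L2_inner ?B (tr qn l) \<mu> = L2_inner (?M l) (d\<eta> l) f - L2_inner ?B (gn l) \<mu>"
      unfolding v(2-) by (rule flux_n[OF v(1) l])
    show "L2_inner (?M l) (\<lambda>x. kb l (p i l x) *\<^sub>R q (Suc i) l x) f - L2_inner (?M l) (p (Suc i) l) df
      + \<alpha> * L2_inner ?B (tr (q (Suc i)) l) \<mu> = L2_inner (?M l) (d\<eta> l) f - L2_inner ?B (g (Suc i) l) \<mu>"
      unfolding v(2-) by (rule flux_i[OF v(1) l])
  qed
  have decay: "(\<Sum>l\<in>{1,2}. \<tau>\<^sup>2 / (2 * L l) * D (Suc i) l) \<le> En i - En (Suc i)" for i
  proof -
    \<comment> \<open>The boundary term left by each subdomain is the next Robin error of the other
      one, so the swap disappears in the sum over both.\<close>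
    have "G (Suc (Suc i)) 1 = \<tau> / (4 * \<alpha>) * L2_inner ?B (h 2 (Suc i)) (h 2 (Suc i))"
      "G (Suc (Suc i)) 2 = \<tau> / (4 * \<alpha>) * L2_inner ?B (h 1 (Suc i)) (h 1 (Suc i))"
      using robin[of 1 2 "Suc i"] robin[of 2 1 "Suc i"] by (simp_all add: G_def)
    then show ?thesis using energy[of 1 i] energy[of 2 i] by (simp add: En_def)
  qed

  \<comment> \<open>Passage to the limit\<close>
  have D_nonneg: "0 \<le> \<tau>\<^sup>2 / (2 * L l) * D i l" if "l \<in> {1,2}" for i l
    using L_pos[OF that] by (simp add: D_def L2_inner_self_nonneg)
  have En_dec: "decseq En"
  proof (rule decseq_SucI)
    fix i show "En (Suc i) \<le> En i"
      using order_trans[OF sum_nonneg[OF D_nonneg] decay] by simp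
  qed
  have "0 \<le> En i" for i
    unfolding En_def G_def P_def using alpha_pos tau_pos L_pos
    by (intro sum_nonneg add_nonneg_nonneg mult_nonneg_nonneg L2_inner_self_nonneg) (auto intro: less_imp_le)
  \<comment> \<open>A decreasing energy bounded below converges, so its decrements tend to zero and
    squeeze the divergence errors.\<close>
  then obtain e where "En \<longlonglongrightarrow> e" using decseq_convergent[OF En_dec] by blast
  then have En_diff: "(\<lambda>i. En i - En (Suc i)) \<longlonglongrightarrow> 0"
    using tendsto_diff[OF _ LIMSEQ_Suc] by fastforce
  have D_lim: "(\<lambda>i. D i l) \<longlonglongrightarrow> 0" if l: "l \<in> {1,2}" for l
  proof -
    have "(\<lambda>i. \<tau>\<^sup>2 / (2 * L l) * D (Suc i) l) \<longlonglongrightarrow> 0"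
    proof (rule tendsto_sandwich[OF _ _ tendsto_const En_diff])
      show "\<forall>\<^sub>F i in sequentially. 0 \<le> \<tau>\<^sup>2 / (2 * L l) * D (Suc i) l"
        using D_nonneg[OF l] by simp
      show "\<forall>\<^sub>F i in sequentially. \<tau>\<^sup>2 / (2 * L l) * D (Suc i) l \<le> En i - En (Suc i)"
        by (intro always_eventually allI order_trans[OF member_le_sum[OF l] decay] D_nonneg) auto
    qed
    from tendsto_mult_left[OF this, of "2 * L l / \<tau>\<^sup>2"]
    have "(\<lambda>i. D (Suc i) l) \<longlonglongrightarrow> 0" using L_pos[OF l] tau_pos by simp
    then show ?thesis by (rule LIMSEQ_imp_Suc)
  qed
  \<comment> \<open>The claim concerns the weak divergence of the flux error, the energy the
    difference of two weak divergences; they agree almost everywhere and so have the same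
    norm.\<close>
  have W_diff: "(L2_norm (?M l) (?W l (\<lambda>x. qn l x - q i l x)))\<^sup>2 = D i l" if l: "l \<in> {1,2}" for i l
  proof -
    note H = QH(1)[OF spaces_n(1) l] QH(1)[OF spaces(1) l, of i]
    have "L2_norm (?M l) (?W l (\<lambda>x. qn l x - q i l x))
        = L2_norm (?M l) (\<lambda>x. ?W l (qn l) x - ?W l (q i l) x)"
      by (rule L2_norm_cong_AE[OF L2_measurable[OF weak_div_props(1)[OF Hdiv_diff]]
            L2_measurable[OF L2_diff] weak_div_diff])
        (intro dom[OF l] H weak_div_props)+
    then show ?thesis by (simp add: L2_norm_sq D_def)
  qed
  have "(\<lambda>i. sqrt (\<Sum>l\<in>{1,2}. D i l)) \<longlonglongrightarrow> sqrt (\<Sum>l\<in>{1,2::nat}. 0)"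
    by (intro tendsto_real_sqrt tendsto_sum D_lim)
  then show ?thesis unfolding broken_norm_def by (simp add: W_diff)
qed

end
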